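(* Let $k\ge 3$ and let $\mathcal{D}=(P,\mathcal{B})$ be a symmetric $(2^k-1,2^{k-1},2^{k-2})$-design which is $(2^{k-1}-1)$-pyramidal over an abelian group $G$, i.e. $G$ is an abelian group of automorphisms of $\mathcal{D}$ which leaves precisely $2^{k-1}-1$ points of $\mathcal{D}$ fixed and acts sharply transitively on the remaining points. Let $O\subset P$ be the complement of the set of fixed points of $G$. Then $O$ is a center block of $\mathcal{D}$, the design $\mathcal{D}$ is (with respect to the center block $O$) the sum of a symmetric $(2^{k-1}-1,2^{k-2},2^{k-3})$-design and the design of points and hyperplane complements of $\mathrm{PG}(k-2,2)$, and $G=C_2^{k-1}(O)$.
   Context: A symmetric $(v,\kappa,\lambda)$-design is a pair $\mathcal{D}=(P,\mathcal{B})$, where $P$ is a set of $v$ points and $\mathcal{B}$ is a set of precisely $v$ subsets of $P$, called blocks, each consisting of $\kappa$ points, such that any two distinct blocks intersect in precisely $\lambda$ points. An isomorphism of designs is a bijection between the point sets that maps blocks to blocks (inducing a bijection of the block sets); an automorphism is an isomorphism of a design to itself, so groups of automorphisms are subgroups of the group of permutations of $P$. Sharply transitive means transitive with trivial point stabilizers. The design of points and hyperplane complements of $\mathrm{PG}(d,2)$ has the points of $\mathrm{PG}(d,2)$ as points and the complements of hyperplanes as blocks. Let $k\ge 3$ and let $\mathcal{D}=(P,\mathcal{B})$ be a symmetric $(2^k-1,2^{k-1},2^{k-2})$-design. A block $O\in\mathcal{B}$ is a center block if for every block $B\neq O$ the symmetric difference $O\triangle B$ is a block. Let $O$ be a center block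 and put $O^c=P\setminus O$. It is known that $\mathcal{D}_O=(O^c,\mathcal{B}_O)$ with $\mathcal{B}_O=\{B\cap O^c: B\in\mathcal{B},\,B\ne O\}$ is a symmetric $(2^{k-1}-1,2^{k-2},2^{k-3})$-design, and that for every $(2^{k-1}-1)$-element subset $Z\subset O$ the pair $\mathcal{D}_Z=(Z,\mathcal{B}_Z)$ with $\mathcal{B}_Z=\{B\cap O: B\in\mathcal{B},\,B\ne O,\,B\cap O\subset Z\}$ is a symmetric $(2^{k-1}-1,2^{k-2},2^{k-3})$-design; moreover there is a unique bijection $\delta_Z:\mathcal{B}_O\to\mathcal{B}_Z$ such that $\mathcal{B}$ consists of $O$ and all $X\cup\delta_Z(X)$, $X\cup(O\setminus\delta_Z(X))$ with $X\in\mathcal{B}_O$. $\mathcal{D}$ is said to be the sum (with respect to $O$) of $\mathcal{D}_O$ and the design of points and hyperplane complements of $\mathrm{PG}(k-2,2)$ if for every $(2^{k-1}-1)$-element subset $Z\subset O$ the design $\mathcal{D}_Z$ is isomorphic to the design of points and hyperplane complements of $\mathrm{PG}(k-2,2)$. In that case the group $C_2^{k-1}(O)$ is defined as follows. Take a $(2^{k-1}-1)$-element subset $Z\subset O$ and let $p'$ be the unique point of $O\setminus Z$. For every $p\in Z$ the set $Z\setminus\{p\}$ is uniquely partitioned into pairs $\{q_1,t_1\},\dots,\{q_{2^{k-2}-1},t_{2^{k-2}-1}\}$ such that no block of $\mathcal{D}_Z$ contains $\{p,q_i,t_i\}$. Let $\alpha_p$ be the permutation $(p,p')(q_1,t_1)\cdots(q_{2^{k-2}-1},t_{2^{k-2}-1})$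 of $P$ (fixing every point of $O^c$). The permutations $\alpha_p$, $p\in Z$, together with the identity form a group of automorphisms of $\mathcal{D}$ isomorphic to $C_2^{k-1}$ (the direct product of $k-1$ copies of the cyclic group of order $2$), and this group does not depend on the choice of $Z$; it is denoted $C_2^{k-1}(O)$. *)

theory Defs
  imports
    Complex_Main
    "HOL-Algebra.Bij"
    "HOL-Library.Disjoint_Sets"
    "HOL-Library.Function_Algebras"
    "HOL-Library.Z2"
begin

section \<open>Symmetric designs\<close>

definition symmetric_design :: "nat \<Rightarrow> nat \<Rightarrow> nat \<Rightarrow> 'a set \<Rightarrow> 'a set set \<Rightarrow> bool" where
  "symmetric_design v \<kappa> l P B \<longleftrightarrow>
     finite P \<and> card P = v \<and> B \<subseteq> Pow P \<and> card B = v \<and>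
     (\<forall>X\<in>B. card X = \<kappa>) \<and>
     (\<forall>X\<in>B. \<forall>Y\<in>B. X \<noteq> Y \<longrightarrow> card (X \<inter> Y) = l)"

definition design_iso ::
    "('a \<Rightarrow> 'b) \<Rightarrow> 'a set \<Rightarrow> 'a set set \<Rightarrow> 'b set \<Rightarrow> 'b set set \<Rightarrow> bool" where
  "design_iso f P B P' B' \<longleftrightarrow> bij_betw f P P' \<and> bij_betw ((`) f) B B'"

definition isomorphic_designs ::
    "'a set \<Rightarrow> 'a set set \<Rightarrow> 'b set \<Rightarrow> 'b set set \<Rightarrow> bool" where
  "isomorphic_designs P B P' B' \<longleftrightarrow> (\<exists>f. design_iso f P B P' B')"

text \<open>As in \<^const>\<open>BijGroup\<close>, a permutation of \<open>P\<close> is represented by an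
  extensional function, i.e. one that is \<^const>\<open>undefined\<close> outside \<open>P\<close>.\<close>

definition automorphisms :: "'a set \<Rightarrow> 'a set set \<Rightarrow> ('a \<Rightarrow> 'a) set" where
  "automorphisms P B = {f \<in> Bij P. design_iso f P B P B}"

definition abelian_automorphism_group ::
    "'a set \<Rightarrow> 'a set set \<Rightarrow> ('a \<Rightarrow> 'a) set \<Rightarrow> bool" where
  "abelian_automorphism_group P B G \<longleftrightarrow>
     subgroup G (BijGroup P) \<and> G \<subseteq> automorphisms P B \<and>
     comm_group ((BijGroup P)\<lparr>carrier := G\<rparr>)"

definition fixed_points :: "'a set \<Rightarrow> ('a \<Rightarrow> 'a) set \<Rightarrow> 'a set" where
  "fixed_points P G = {x \<in> P. \<forall>g\<in>G. g x = x}"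

text \<open>\<open>G\<close> is a group of permutations of \<open>P\<close>, considered in its action on \<open>X \<subseteq> P\<close>.\<close>

definition sharply_transitive_on :: "'a set \<Rightarrow> ('a \<Rightarrow> 'a) set \<Rightarrow> 'a set \<Rightarrow> bool" where
  "sharply_transitive_on P G X \<longleftrightarrow>
     (\<forall>x\<in>X. \<forall>y\<in>X. \<exists>g\<in>G. g x = y) \<and>
     (\<forall>x\<in>X. {g \<in> G. g x = x} = {\<one>\<^bsub>BijGroup P\<^esub>})"

definition pyramidal_over_abelian ::
    "nat \<Rightarrow> 'a set \<Rightarrow> 'a set set \<Rightarrow> ('a \<Rightarrow> 'a) set \<Rightarrow> bool" where
  "pyramidal_over_abelian f P B G \<longleftrightarrow>
     abelian_automorphism_group P B G \<and>
     card (fixed_points P G) = f \<and>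
     sharply_transitive_on P G (P - fixed_points P G)"


section \<open>Points and hyperplane complements of \<open>PG(d,2)\<close>\<close>

text \<open>The vector space \<open>\<bbbF>\<^sub>2\<^sup>n\<close> is represented by the functions \<open>nat \<Rightarrow> bit\<close> vanishing
  on \<open>{n..}\<close>, with pointwise operations.\<close>

definition scale_F2 :: "bit \<Rightarrow> (nat \<Rightarrow> bit) \<Rightarrow> (nat \<Rightarrow> bit)" where
  "scale_F2 c v = (\<lambda>i. c * v i)"

global_interpretation F2: vector_space scale_F2
  by unfold_locales (auto simp: scale_F2_def fun_eq_iff distrib_left distrib_right)

definition F2_space :: "nat \<Rightarrow> (nat \<Rightarrow> bit) set" where
  "F2_space n = {v. \<forall>i\<ge>n. v i = 0}"

text \<open>Dimensions below are vector space dimensions: a hyperplane of \<open>PG(d,2)\<close> is a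
  \<open>d\<close>-dimensional subspace of \<open>\<bbbF>\<^sub>2\<^sup>d\<^sup>+\<^sup>1\<close>.\<close>

definition PG_points :: "nat \<Rightarrow> (nat \<Rightarrow> bit) set set" where
  "PG_points d = {U. F2.subspace U \<and> U \<subseteq> F2_space (d + 1) \<and> F2.dim U = 1}"

definition PG_hyperplanes :: "nat \<Rightarrow> (nat \<Rightarrow> bit) set set" where
  "PG_hyperplanes d = {H. F2.subspace H \<and> H \<subseteq> F2_space (d + 1) \<and> F2.dim H = d}"

definition PG_hyperplane_complements :: "nat \<Rightarrow> (nat \<Rightarrow> bit) set set set" where
  "PG_hyperplane_complements d =
     {{U \<in> PG_points d. \<not> U \<subseteq> H} | H. H \<in> PG_hyperplanes d}"


section \<open>Center blocks and sums\<close>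

definition center_block :: "'a set set \<Rightarrow> 'a set \<Rightarrow> bool" where
  "center_block B C \<longleftrightarrow> C \<in> B \<and> (\<forall>X\<in>B. X \<noteq> C \<longrightarrow> sym_diff C X \<in> B)"

text \<open>The block sets of the designs on \<open>P - C\<close> and on \<open>Z \<subseteq> C\<close>, respectively.\<close>

definition outer_blocks :: "'a set \<Rightarrow> 'a set set \<Rightarrow> 'a set \<Rightarrow> 'a set set" where
  "outer_blocks P B C = {X \<inter> (P - C) | X. X \<in> B \<and> X \<noteq> C}"

definition inner_blocks :: "'a set set \<Rightarrow> 'a set \<Rightarrow> 'a set \<Rightarrow> 'a set set" where
  "inner_blocks B C Z = {X \<inter> C | X. X \<in> B \<and> X \<noteq> C \<and> X \<inter> C \<subseteq> Z}"

text \<open>The first summand \<open>(P1, B1)\<close> is always the design induced on the complement of \<open>C\<close>.\<close>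

definition is_sum_with_PG ::
    "nat \<Rightarrow> 'a set \<Rightarrow> 'a set set \<Rightarrow> 'a set \<Rightarrow> 'a set \<Rightarrow> 'a set set \<Rightarrow> bool" where
  "is_sum_with_PG k P B C P1 B1 \<longleftrightarrow>
     P1 = P - C \<and> B1 = outer_blocks P B C \<and>
     (\<forall>Z. Z \<subseteq> C \<and> card Z = 2 ^ (k - 1) - 1 \<longrightarrow>
        isomorphic_designs Z (inner_blocks B C Z)
          (PG_points (k - 2)) (PG_hyperplane_complements (k - 2)))"


section \<open>The group \<open>C\<^sub>2\<^sup>k\<^sup>-\<^sup>1(C)\<close>\<close>

text \<open>The partition of \<open>Z - {p}\<close> into pairs \<open>{q, t}\<close> such that no block in \<open>BZ\<close>
  contains \<open>{p, q, t}\<close>.\<close>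

definition pairing :: "'a set \<Rightarrow> 'a set set \<Rightarrow> 'a \<Rightarrow> 'a set set" where
  "pairing Z BZ p = (THE Q. partition_on (Z - {p}) Q \<and>
     (\<forall>S\<in>Q. card S = 2 \<and> (\<forall>X\<in>BZ. \<not> insert p S \<subseteq> X)))"

definition alpha :: "'a set \<Rightarrow> 'a set set \<Rightarrow> 'a set \<Rightarrow> 'a set \<Rightarrow> 'a \<Rightarrow> ('a \<Rightarrow> 'a)" where
  "alpha P B C Z p = (let p' = (THE x. x \<in> C - Z) in
     (\<lambda>x\<in>P. if x = p then p'
            else if x = p' then p
            else if x \<in> Z then (THE t. {x, t} \<in> pairing Z (inner_blocks B C Z) p)
            else x))"

definition C2_group :: "'a set \<Rightarrow> 'a set set \<Rightarrow> 'a set \<Rightarrow> 'a set \<Rightarrow> ('a \<Rightarrow> 'a) set" where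
  "C2_group P B C Z = insert (\<one>\<^bsub>BijGroup P\<^esub>) (alpha P B C Z ` Z)"

end

theory Submission
  imports Defs "HOL-Algebra.Group_Action" "HOL-Computational_Algebra.Primes"
begin

text \<open>Write \<open>q = 2 ^ (k - 3)\<close>, so that there are \<open>8 q - 1\<close> points, blocks have \<open>4 q\<close> points and
  distinct blocks share \<open>2 q\<close> points. The set \<open>C\<close> of points moved by \<open>G\<close> has \<open>4 q\<close> points, and so
  does \<open>G\<close>.

  As a \<open>2\<close>-group acting on an odd number of blocks, \<open>G\<close> fixes some block. That block is a union
  of orbits on points, and the size of blocks leaves only \<open>C\<close> itself (\<open>C_block\<close>). Let \<open>X\<close> be another
  block. Its \<open>2 q\<close> points outside \<open>C\<close> are fixed by \<open>G\<close>; so if \<open>g \<in> G\<close> moves \<open>X\<close>, these points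
  already exhaust \<open>g ` X \<inter> X\<close>. Hence \<open>g ` X\<close> is either \<open>X\<close> or \<open>C \<triangle> X\<close> (\<open>image_block_cases\<close>). The
  second case occurs because \<open>G\<close> is transitive on \<open>C\<close>, and therefore \<open>C\<close> is a center block.

  Fix a point \<open>base\<close> of \<open>C\<close> and choose from each pair \<open>{X, C \<triangle> X}\<close> the block that avoids \<open>base\<close>.
  The \<open>\<plusminus>1\<close> vectors of these \<open>4 q - 1\<close> blocks on \<open>C\<close>, together with the all-one vector, form a Hadamard
  matrix, so its columns are orthogonal as well (\<open>columns_orthogonal\<close>). By the dichotomy above
  each row is a character of \<open>G\<close> once \<open>C\<close> is identified with \<open>G\<close> through \<open>g \<mapsto> g base\<close>
  (\<open>sign_mult\<close>). Since distinct columns differ, every square in \<open>G\<close> is trivial (\<open>involution\<close>).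

  Let \<open>Z = C - {base}\<close>. A character cannot be \<open>-1\<close> at \<open>p\<close>, at \<open>x\<close> and at their product, so no block of
  the inner design contains \<open>p\<close>, \<open>x\<close> and \<open>g x\<close>, where \<open>g \<in> G\<close> takes \<open>base\<close> to \<open>p\<close>. The column relations
  show that every other triple lies in a block (\<open>block_through_three_points\<close>). This determines the
  pairing and identifies \<open>\<alpha>\<^sub>p\<close> with \<open>g\<close>, whence \<open>G\<close> is the group in question (\<open>C2_group_eq\<close>).

  Finally \<open>G\<close> is isomorphic to \<open>\<bbbF>\<^sub>2\<^sup>k\<^sup>-\<^sup>1\<close>. In these coordinates the points of \<open>Z\<close> are the
  nonzero vectors, and a block of the inner design is the complement of the kernel of a nontrivial
  character, that is, of a hyperplane. As there are at most \<open>4 q - 1\<close> hyperplanes, all of them arise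
  (\<open>inner_design_isomorphic_PG\<close>).\<close>


section \<open>Hyperplanes of binary vector spaces\<close>

lemma F2_add_self [simp]: "(v :: nat \<Rightarrow> bit) + v = 0"
  by (simp add: fun_eq_iff)

lemma F2_uminus [simp]: "- (v :: nat \<Rightarrow> bit) = v"
  by (simp add: fun_eq_iff)

lemma F2_add_add_self [simp]: "(v :: nat \<Rightarrow> bit) + (v + w) = w"
  by (simp add: fun_eq_iff flip: add.assoc)

lemma scale_F2_simps [simp]: "scale_F2 0 v = 0" "scale_F2 1 v = v"
  by (simp_all add: scale_F2_def fun_eq_iff)

lemma F2_subspace_iff:
  "F2.subspace U \<longleftrightarrow> 0 \<in> U \<and> (\<forall>v\<in>U. \<forall>w\<in>U. v + w \<in> U)"
proof
  assume U: "0 \<in> U \<and> (\<forall>v\<in>U. \<forall>w\<in>U. v + w \<in> U)"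
  have "scale_F2 c v \<in> U" if "v \<in> U" for c v
    using U that by (cases c) auto
  then show "F2.subspace U"
    using U by (simp add: F2.subspace_def)
qed (simp add: F2.subspace_def)

lemma subspace_F2_space: "F2.subspace (F2_space n)"
  by (auto simp: F2_subspace_iff F2_space_def)

lemma F2_space_0: "F2_space 0 = {0}"
  by (auto simp: F2_space_def fun_eq_iff)

lemma F2_space_mono: "m \<le> n \<Longrightarrow> F2_space m \<subseteq> F2_space n"
  by (auto simp: F2_space_def)

definition F2_unit :: "nat \<Rightarrow> nat \<Rightarrow> bit" where
  "F2_unit i = (\<lambda>j. if j = i then 1 else 0)"

lemma F2_unit_in_space: "i < n \<Longrightarrow> F2_unit i \<in> F2_space n"
  by (auto simp: F2_space_def F2_unit_def)

lemma F2_unit_notin_space: "F2_unit n \<notin> F2_space n"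
  by (auto simp: F2_space_def F2_unit_def)

lemma F2_space_Suc_cases:
  assumes "v \<in> F2_space (Suc n)"
  obtains "v \<in> F2_space n" | "v + F2_unit n \<in> F2_space n"
proof (cases "v n")
  case zero
  with assms have "v i = 0" if "i \<ge> n" for i
    using that by (cases "i = n") (auto simp: F2_space_def)
  then show ?thesis using that by (auto simp: F2_space_def)
next
  case one
  with assms have "(v + F2_unit n) i = 0" if "i \<ge> n" for i
    using that by (cases "i = n") (auto simp: F2_space_def F2_unit_def)
  then show ?thesis using that by (auto simp: F2_space_def)
qed

lemma F2_space_induct [consumes 1, case_names zero add_unit]:
  assumes "v \<in> F2_space n" and "Q 0"
    and "\<And>m v. m < n \<Longrightarrow> v \<in> F2_space m \<Longrightarrow> Q v \<Longrightarrow> Q (v + F2_unit m)"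
  shows "Q v"
  using assms(1,3)
proof (induction n arbitrary: v)
  case 0
  then have "v = 0" by (simp add: F2_space_0)
  then show ?case using assms(2) by blast
next
  case (Suc n)
  from Suc.prems(1) show ?case
  proof (cases rule: F2_space_Suc_cases)
    case 2
    then have "Q ((v + F2_unit n) + F2_unit n)"
      using Suc by (meson less_Suc_eq lessI)
    then show ?thesis by (simp add: add.assoc)
  qed (use Suc in auto)
qed

lemma F2_space_finite_card: "finite (F2_space n) \<and> card (F2_space n) = 2 ^ n"
proof -
  let ?f = "\<lambda>S i. if i \<in> S then 1 else (0 :: bit)"
  have "v \<in> ?f ` Pow {..<n}" if "v \<in> F2_space n" for v
  proof (rule image_eqI)
    show "v = ?f {i. v i = 1}"
      by (auto simp: fun_eq_iff)
    show "{i. v i = 1} \<in> Pow {..<n}"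
      using that by (fastforce simp: F2_space_def not_less[symmetric])
  qed
  then have "F2_space n = ?f ` Pow {..<n}"
    by (auto simp: F2_space_def)
  moreover have "inj_on ?f (Pow {..<n})"
    by (auto simp: inj_on_def fun_eq_iff split: if_splits)
  ultimately show ?thesis
    by (simp add: card_image card_Pow)
qed

text \<open>A basis of a subspace of index two becomes a basis of the whole space when any vector outside is
  added to it.\<close>

lemma dim_F2_index_two:
  assumes H: "F2.subspace H" "finite H" and V: "F2.subspace V" "H \<subseteq> V"
    and w: "w \<in> V" "w \<notin> H" and index: "\<And>v. v \<in> V \<Longrightarrow> v \<notin> H \<Longrightarrow> v + w \<in> H"
  shows "F2.dim V = Suc (F2.dim H)"
proof -
  obtain A where A: "A \<subseteq> H" "F2.independent A" "H \<subseteq> F2.span A" "card A = F2.dim H"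
    using F2.basis_exists by blast
  have fin: "finite A" using A(1) H(2) finite_subset by blast
  have span: "F2.span A = H"
    using A(1,3) H(1) F2.span_minimal by blast
  have "w \<notin> A" using A(1) w by blast
  moreover have "F2.independent (insert w A)"
    using A(2) w span F2.independent_insertI by blast
  moreover have "F2.span (insert w A) = V"
  proof
    show "F2.span (insert w A) \<subseteq> V"
      using A(1) V w by (intro F2.span_minimal) auto
    show "V \<subseteq> F2.span (insert w A)"
    proof
      fix v assume v: "v \<in> V"
      have H': "H \<subseteq> F2.span (insert w A)"
        using span F2.span_mono[of A "insert w A"] by blast
      show "v \<in> F2.span (insert w A)"
      proof (cases "v \<in> H")
        case False
        then have "v + w \<in> F2.span (insert w A)" "w \<in> F2.span (insert w A)"
          using index[OF v] H' F2.span_base[of w "insert w A"] by auto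
        then have "(v + w) + w \<in> F2.span (insert w A)" by (rule F2.span_add)
        then show ?thesis by (simp add: add.assoc)
      qed (use H' in auto)
    qed
  qed
  moreover have "F2.span V = V" using V(1) F2.span_eq_iff by blast
  ultimately have "F2.dim V = card (insert w A)"
    using F2.dim_eq_card by metis
  then show ?thesis using A fin \<open>w \<notin> A\<close> by simp
qed

lemma dim_F2_space: "F2.dim (F2_space n) = n"
proof (induction n)
  case 0
  show ?case
    using F2.dim_eq_card_independent[of "{}"] F2.dim_span[of "{}"]
    by (simp add: F2_space_0 F2.independent_empty)
next
  case (Suc n)
  have "F2.dim (F2_space (Suc n)) = Suc (F2.dim (F2_space n))"
    using F2_space_finite_card F2_unit_in_space F2_unit_notin_space F2_space_mono
    by (intro dim_F2_index_two[where w = "F2_unit n"] subspace_F2_space)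
       (auto elim: F2_space_Suc_cases)
  then show ?case using Suc by simp
qed

text \<open>Over \<open>\<bbbF>\<^sub>2\<close> hyperplanes are the subgroups of index two. This turns the dimension into a condition
  on sums of vectors, which is what the designs provide. If \<open>v\<close>, \<open>w\<close> and \<open>v + w\<close> were all outside a
  \<open>d\<close>-dimensional subspace, then \<open>v\<close> and \<open>w\<close> would extend a basis of it to \<open>d + 2\<close> independent
  vectors.\<close>

lemma PG_hyperplanes_iff:
  "H \<in> PG_hyperplanes d \<longleftrightarrow> F2.subspace H \<and> H \<subset> F2_space (d + 1) \<and>
     (\<forall>v\<in>F2_space (d + 1) - H. \<forall>w\<in>F2_space (d + 1) - H. v + w \<in> H)"
    (is "_ \<longleftrightarrow> ?R")
proof
  assume R: ?R
  then obtain w where w: "w \<in> F2_space (d + 1)" "w \<notin> H" by blast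
  have "F2.dim (F2_space (d + 1)) = Suc (F2.dim H)"
    by (rule dim_F2_index_two[where w = w])
       (use R w F2_space_finite_card[of "d + 1"] subspace_F2_space in
         \<open>auto intro: finite_subset\<close>)
  then show "H \<in> PG_hyperplanes d"
    using R by (auto simp: PG_hyperplanes_def dim_F2_space)
next
  assume "H \<in> PG_hyperplanes d"
  then have H: "F2.subspace H" "H \<subseteq> F2_space (d + 1)" "F2.dim H = d"
    by (auto simp: PG_hyperplanes_def)
  have "H \<noteq> F2_space (d + 1)"
    using H(3) dim_F2_space[of "d + 1"] by auto
  moreover have "v + w \<in> H"
    if v: "v \<in> F2_space (d + 1)" "v \<notin> H" and w: "w \<in> F2_space (d + 1)" "w \<notin> H" for v w
  proof (rule ccontr)
    assume vw: "v + w \<notin> H"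
    obtain A where A: "A \<subseteq> H" "F2.independent A" "H \<subseteq> F2.span A" "card A = d"
      using F2.basis_exists H(3) by metis
    have fin: "finite A"
      using A(1) H(2) F2_space_finite_card finite_subset by metis
    have span: "F2.span A = H"
      using A(1,3) H(1) F2.span_minimal by blast
    have ind: "F2.independent (insert v A)"
      using A(2) v span F2.independent_insertI by blast
    have "w \<notin> F2.span (insert v A)"
    proof
      assume "w \<in> F2.span (insert v A)"
      then obtain c where "w - scale_F2 c v \<in> F2.span A"
        using F2.span_breakdown_eq[of w v A] by auto
      then show False
        using w vw span by (cases c) (auto simp: add.commute diff_conv_add_uminus
            simp del: add_uminus_conv_diff)
    qed
    with ind have ind': "F2.independent (insert w (insert v A))"
      using F2.independent_insertI by blast
    obtain A' where A': "A' \<subseteq> F2_space (d + 1)" "F2_space (d + 1) \<subseteq> F2.span A'"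
        "card A' = d + 1"
      using F2.basis_exists[of "F2_space (d + 1)"] dim_F2_space by metis
    have "card (insert w (insert v A)) \<le> card A'"
    proof (rule conjunct2[OF F2.independent_span_bound[OF _ ind']])
      show "finite A'" using A'(1) F2_space_finite_card finite_subset by metis
      show "insert w (insert v A) \<subseteq> F2.span A'" using A' A H v w by blast
    qed
    moreover have "v \<notin> A" using A(1) v by blast
    moreover have "w \<notin> insert v A"
      using \<open>w \<notin> F2.span (insert v A)\<close> F2.span_base by blast
    ultimately show False using A A' fin by simp
  qed
  ultimately show ?R using H by auto
qed

text \<open>A subgroup of index two is determined by the unit vectors that it contains, and it cannot contain
  all of them.\<close>

lemma finite_card_PG_hyperplanes:
  "finite (PG_hyperplanes d) \<and> card (PG_hyperplanes d) \<le> 2 ^ (d + 1) - 1"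
proof -
  let ?n = "d + 1"
  define units where "units = (\<lambda>H. {i. i < ?n \<and> F2_unit i \<in> H})"
  have add_iff: "v + w \<in> H \<longleftrightarrow> (v \<in> H \<longleftrightarrow> w \<in> H)"
    if "H \<in> PG_hyperplanes d" "v \<in> F2_space ?n" "w \<in> F2_space ?n" for H v w
  proof -
    have *: "F2.subspace H" "\<forall>v\<in>F2_space ?n - H. \<forall>w\<in>F2_space ?n - H. v + w \<in> H"
      using that(1) unfolding PG_hyperplanes_iff by auto
    have "w \<in> H" if "v \<in> H" "v + w \<in> H"
      using F2.subspace_add[OF *(1) that] by simp
    moreover have "v \<in> H" if "w \<in> H" "v + w \<in> H"
      using F2.subspace_add[OF *(1) that] by (simp add: add.left_commute)
    moreover have "v + w \<in> H" if "v \<in> H" "w \<in> H"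
      using F2.subspace_add[OF *(1) that] .
    ultimately show ?thesis using * that by blast
  qed
  have unit: "F2_unit m \<in> F2_space ?n" "v \<in> F2_space ?n"
    if "m < ?n" "v \<in> F2_space m" for m v
    using that F2_unit_in_space F2_space_mono[of m ?n] by auto
  have "v \<in> H \<longleftrightarrow> v \<in> H'"
    if H: "H \<in> PG_hyperplanes d" "H' \<in> PG_hyperplanes d" "units H = units H'"
      and v: "v \<in> F2_space ?n" for H H' v
    using v
  proof (induction rule: F2_space_induct)
    case zero
    have "0 \<in> H" "0 \<in> H'"
      using H unfolding PG_hyperplanes_iff F2_subspace_iff by blast+
    then show ?case by blast
  next
    case (add_unit m v)
    moreover have "F2_unit m \<in> H \<longleftrightarrow> F2_unit m \<in> H'"
      using H(3) add_unit by (auto simp: units_def)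
    ultimately show ?case
      using H unit[of m v] add_iff by blast
  qed
  then have inj: "inj_on units (PG_hyperplanes d)"
    by (intro inj_onI Set.set_eqI) (metis PG_hyperplanes_iff psubsetD)
  have "units ` PG_hyperplanes d \<subseteq> Pow {..<?n} - {{..<?n}}"
  proof safe
    fix H i assume "i \<in> units H" then show "i < ?n" by (simp add: units_def)
  next
    fix H assume H: "H \<in> PG_hyperplanes d" and "units H = {..<?n}"
    then have "F2_unit i \<in> H" if "i < ?n" for i using that by (auto simp: units_def)
    have "v \<in> H" if "v \<in> F2_space ?n" for v
      using that
    proof (induction rule: F2_space_induct)
      case zero
      show ?case using H unfolding PG_hyperplanes_iff F2_subspace_iff by blast
    next
      case (add_unit m v)
      then show ?case
        using H unit[of m v] \<open>\<And>i. i < ?n \<Longrightarrow> F2_unit i \<in> H\<close> add_iff by blast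
    qed
    then show False using H by (force simp: PG_hyperplanes_iff)
  qed
  moreover have "finite (Pow {..<?n} - {{..<?n}})" 
    "card (Pow {..<?n} - {{..<?n}}) = 2 ^ ?n - 1"
    by (simp_all add: card_Pow card_Diff_singleton)
  ultimately show ?thesis
    using inj by (metis card_mono finite_imageD card_image finite_subset)
qed

lemma PG_points_eq: "PG_points d = (\<lambda>v. {0, v}) ` (F2_space (d + 1) - {0})"
proof (intro Set.set_eqI iffI)
  fix U assume "U \<in> PG_points d"
  then have U: "F2.subspace U" "U \<subseteq> F2_space (d + 1)" "F2.dim U = 1"
    by (auto simp: PG_points_def)
  obtain A where A: "A \<subseteq> U" "F2.independent A" "U \<subseteq> F2.span A" "card A = 1"
    using F2.basis_exists U(3) by metis
  then obtain v where v: "A = {v}" by (auto simp: card_1_singleton_iff)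
  have "v \<noteq> 0" using A(2) v F2.dependent_zero by blast
  have "F2.span {v} = {0, v}"
  proof -
    have "F2.span {v} = range (\<lambda>c. scale_F2 c v)" by (rule F2.span_singleton)
    also have "(UNIV :: bit set) = {0, 1}" by (auto intro: bit.exhaust)
    finally show ?thesis by simp
  qed
  then have "U = {0, v}"
    using A v U(1) by (auto simp: F2_subspace_iff)
  then show "U \<in> (\<lambda>v. {0, v}) ` (F2_space (d + 1) - {0})"
    using \<open>v \<noteq> 0\<close> U(2) by blast
next
  fix U assume "U \<in> (\<lambda>v. {0, v}) ` (F2_space (d + 1) - {0})"
  then obtain v where v: "v \<in> F2_space (d + 1)" "v \<noteq> 0" "U = {0, v}" by blast
  have sub: "F2.subspace {0, v}" "F2.subspace {0}" by (auto simp: F2_subspace_iff)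
  have "F2.dim {0, v} = Suc (F2.dim {0})"
    by (rule dim_F2_index_two[where w = v]) (use sub v in auto)
  then show "U \<in> PG_points d"
    using v sub dim_F2_space[of 0] subspace_F2_space[of "d + 1"]
    unfolding F2_space_0 PG_points_def F2_subspace_iff by auto
qed

text \<open>The isomorphism is built one coordinate at a time: as long as the image of \<open>\<bbbF>\<^sub>2\<^sup>j\<close> is a proper
  subset of the group, any element \<open>c\<close> outside the image can be taken as the value at the next unit vector.\<close>

lemma (in comm_group) exponent_two_iso_F2_space:
  assumes sq: "\<And>x. x \<in> carrier G \<Longrightarrow> x \<otimes> x = \<one>"
    and fin: "finite (carrier G)" and order: "card (carrier G) = 2 ^ n"
  obtains \<psi> where "bij_betw \<psi> (F2_space n) (carrier G)"
    and "\<And>v w. v \<in> F2_space n \<Longrightarrow> w \<in> F2_space n \<Longrightarrow> \<psi> (v + w) = \<psi> v \<otimes> \<psi> w"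
proof -
  have sq': "x \<otimes> (x \<otimes> y) = y" if "x \<in> carrier G" "y \<in> carrier G" for x y
    using that sq by (simp flip: m_assoc)
  define good where "good = (\<lambda>\<psi> j. inj_on \<psi> (F2_space j) \<and> \<psi> ` F2_space j \<subseteq> carrier G \<and>
      (\<forall>v\<in>F2_space j. \<forall>w\<in>F2_space j. \<psi> (v + w) = \<psi> v \<otimes> \<psi> w))"
  have "\<exists>\<psi>. good \<psi> j" if "j \<le> n" for j
    using that
  proof (induction j)
    case 0
    show ?case by (rule exI[of _ "\<lambda>_. \<one>"]) (simp add: good_def F2_space_0)
  next
    case (Suc j)
    then obtain \<psi> where \<psi>: "good \<psi> j" by auto
    then have inj: "inj_on \<psi> (F2_space j)"
      and closed: "\<And>v. v \<in> F2_space j \<Longrightarrow> \<psi> v \<in> carrier G"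
      and hom: "\<And>v w. v \<in> F2_space j \<Longrightarrow> w \<in> F2_space j \<Longrightarrow> \<psi> (v + w) = \<psi> v \<otimes> \<psi> w"
      by (auto simp: good_def)
    have "card (\<psi> ` F2_space j) < card (carrier G)"
      using inj Suc.prems by (simp add: card_image F2_space_finite_card order)
    then obtain c where c: "c \<in> carrier G" "c \<notin> \<psi> ` F2_space j"
      using closed by (metis card_mono F2_space_finite_card finite_imageI not_le subsetI)
    define \<psi>' where "\<psi>' = (\<lambda>v. if v j = 0 then \<psi> v else c \<otimes> \<psi> (v + F2_unit j))"
    have low: "v j = 0" if "v \<in> F2_space j" for v using that by (simp add: F2_space_def)
    have \<psi>'0: "\<psi>' v = \<psi> v" if "v \<in> F2_space j" for v
      using low[OF that] by (simp add: \<psi>'_def)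
    have \<psi>'1: "\<psi>' (v + F2_unit j) = c \<otimes> \<psi> v" if "v \<in> F2_space j" for v
      using low[OF that] by (simp add: \<psi>'_def F2_unit_def add.assoc)
    have cases: "\<exists>u\<in>F2_space j. v = u \<or> v = u + F2_unit j" if "v \<in> F2_space (Suc j)" for v
      using that
    proof (cases rule: F2_space_Suc_cases)
      case 2
      then show ?thesis by (intro bexI[of _ "v + F2_unit j"]) (simp_all add: add.assoc)
    qed auto
    have add: "u + v \<in> F2_space j" if "u \<in> F2_space j" "v \<in> F2_space j" for u v
      using F2.subspace_add[OF subspace_F2_space] that by blast
    have neq: "c \<otimes> \<psi> u \<noteq> \<psi> v" if "u \<in> F2_space j" "v \<in> F2_space j" for u v
    proof
      assume "c \<otimes> \<psi> u = \<psi> v"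
      then have "\<psi> (u + v) = \<psi> u \<otimes> (c \<otimes> \<psi> u)" using hom that by simp
      also have "\<dots> = c" using closed[OF that(1)] c sq'[of "\<psi> u" c] m_comm[of c "\<psi> u"] by simp
      finally show False using c(2) add[OF that] by blast
    qed
    have "good \<psi>' (Suc j)"
      unfolding good_def
    proof (intro conjI ballI)
      show "inj_on \<psi>' (F2_space (Suc j))"
      proof (rule inj_onI)
        fix v w assume vw: "v \<in> F2_space (Suc j)" "w \<in> F2_space (Suc j)" "\<psi>' v = \<psi>' w"
        obtain a where a: "a \<in> F2_space j" "v = a \<or> v = a + F2_unit j" using cases vw by blast
        obtain b where b: "b \<in> F2_space j" "w = b \<or> w = b + F2_unit j" using cases vw by blast
        show "v = w"
          using a b vw(3) neq[OF a(1) b(1)] neq[OF b(1) a(1)] closed c inj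
          by (auto simp: \<psi>'0 \<psi>'1 dest: inj_onD)
      qed
      show "\<psi>' ` F2_space (Suc j) \<subseteq> carrier G"
        using cases closed c by (auto simp: \<psi>'0 \<psi>'1 dest!: cases)
    next
      fix v w assume vw: "v \<in> F2_space (Suc j)" "w \<in> F2_space (Suc j)"
      obtain a where a: "a \<in> F2_space j" "v = a \<or> v = a + F2_unit j" using cases vw by blast
      obtain b where b: "b \<in> F2_space j" "w = b \<or> w = b + F2_unit j" using cases vw by blast
      \<comment> \<open>Doubling a unit vector gives \<open>0\<close>, just as \<open>c\<close> squares to the identity.\<close>
      have eqs: "a + F2_unit j + b = (a + b) + F2_unit j" "a + (b + F2_unit j) = (a + b) + F2_unit j"
        "a + F2_unit j + (b + F2_unit j) = a + b"
        by (simp_all add: ac_simps)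
      have *: "c \<otimes> \<psi> a \<otimes> (c \<otimes> \<psi> b) = \<psi> a \<otimes> \<psi> b"
        using closed[OF a(1)] closed[OF b(1)] c sq' by (simp add: m_ac)
      show "\<psi>' (v + w) = \<psi>' v \<otimes> \<psi>' w"
        using a(2) b(2) a(1) b(1) closed[OF a(1)] closed[OF b(1)] c add[OF a(1) b(1)] *
        by (elim disjE) (simp_all add: \<psi>'0 \<psi>'1 eqs hom m_ac)
    qed
    then show ?case by blast
  qed
  then obtain \<psi> where \<psi>: "good \<psi> n" by blast
  then have "\<psi> ` F2_space n = carrier G"
    using fin order by (intro card_subset_eq) (auto simp: good_def card_image F2_space_finite_card)
  then show thesis
    using that \<psi> by (auto simp: good_def bij_betw_def)
qed


section \<open>Hadamard matrices and fixed points of 2-groups\<close>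

text \<open>This is the step from \<open>A A\<^sup>T = n I\<close> to \<open>A\<^sup>T A = n I\<close> for a square sign matrix \<open>A\<close>. The squares of the
  entries of \<open>A A\<^sup>T\<close> and of \<open>A\<^sup>T A\<close> have the same sum, namely \<open>n\<^sup>3\<close>. The diagonal of \<open>A\<^sup>T A\<close>
  alone contributes \<open>n\<^sup>3\<close>, so nothing is left for the other entries.\<close>

lemma orthogonal_rows_imp_orthogonal_columns:
  fixes e :: "'i \<Rightarrow> 'c \<Rightarrow> int"
  assumes fin: "finite I" "finite C" and card: "card I = n" "card C = n"
    and rows: "\<And>i j. i \<in> I \<Longrightarrow> j \<in> I \<Longrightarrow>
      (\<Sum>x\<in>C. e i x * e j x) = (if i = j then int n else 0)"
    and signs: "\<And>i x. i \<in> I \<Longrightarrow> x \<in> C \<Longrightarrow> e i x * e i x = 1"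
    and xy: "x \<in> C" "y \<in> C" "x \<noteq> y"
  shows "(\<Sum>i\<in>I. e i x * e i y) = 0"
proof -
  define s where "s = (\<lambda>x y. \<Sum>i\<in>I. e i x * e i y)"
  have diag: "s z z = int n" if "z \<in> C" for z
    using signs that card by (simp add: s_def)
  have "(\<Sum>z\<in>C. \<Sum>w\<in>C. (s z w)\<^sup>2) =
      (\<Sum>z\<in>C. \<Sum>w\<in>C. \<Sum>i\<in>I. \<Sum>j\<in>I. (e i z * e i w) * (e j z * e j w))"
    by (simp add: s_def power2_eq_square sum_product)
  also have "\<dots> = (\<Sum>i\<in>I. \<Sum>j\<in>I. \<Sum>z\<in>C. \<Sum>w\<in>C. (e i z * e i w) * (e j z * e j w))"
    by (simp only: sum.swap[of _ I C])
  also have "\<dots> = (\<Sum>i\<in>I. \<Sum>j\<in>I. (\<Sum>z\<in>C. e i z * e j z)\<^sup>2)"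
    by (simp add: power2_eq_square sum_product mult_ac)
  also have "\<dots> = (\<Sum>i\<in>I. \<Sum>j\<in>I. if i = j then (int n)\<^sup>2 else 0)"
    by (intro sum.cong) (auto simp: rows)
  also have "\<dots> = (\<Sum>z\<in>C. (int n)\<^sup>2)"
    using fin card by simp
  finally have total: "(\<Sum>z\<in>C. \<Sum>w\<in>C. (s z w)\<^sup>2) = (\<Sum>z\<in>C. (int n)\<^sup>2)" .
  have "(\<Sum>w\<in>C. (s z w)\<^sup>2) = (int n)\<^sup>2 + (\<Sum>w\<in>C - {z}. (s z w)\<^sup>2)" if "z \<in> C" for z
    using that fin by (subst sum.remove[of _ z]) (auto simp: diag)
  with total have "(\<Sum>z\<in>C. \<Sum>w\<in>C - {z}. (s z w)\<^sup>2) = 0"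
    by (simp add: sum.distrib)
  then have "(\<Sum>w\<in>C - {x}. (s x w)\<^sup>2) = 0"
    using fin xy by (subst (asm) sum_nonneg_eq_0_iff) (auto intro: sum_nonneg)
  then have "(s x y)\<^sup>2 = 0"
    using fin xy by (subst (asm) sum_nonneg_eq_0_iff) auto
  then show ?thesis by (simp add: s_def)
qed

text \<open>The orbit sizes are powers of two and add up to an odd number, so one of them is \<open>1\<close>.\<close>

lemma (in group_action) two_group_fixed_point:
  assumes fin: "finite E" "odd (card E)" and order: "order G = 2 ^ n"
  obtains x where "x \<in> E" "\<And>g. g \<in> carrier G \<Longrightarrow> \<phi> g x = x"
proof -
  have part: "partition E (orbits G E \<phi>)" by (rule orbit_partition)
  have "\<Union> (orbits G E \<phi>) = E" using partition.partition_coverture[OF part] .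
  moreover have "card (\<Union> (orbits G E \<phi>)) = sum card (orbits G E \<phi>)"
  proof (rule card_Union_disjoint)
    show "pairwise disjnt (orbits G E \<phi>)"
      using partition.disjoint_union[OF part] by (auto simp: pairwise_def disjnt_def)
    show "finite X" if "X \<in> orbits G E \<phi>" for X
      using that fin partition.incl[OF part] finite_subset by blast
  qed
  ultimately have "\<not> (\<forall>X\<in>orbits G E \<phi>. even (card X))"
    using fin dvd_sum[of "orbits G E \<phi>" 2 card] by auto
  then obtain x where x: "x \<in> E" "odd (card (orbit G \<phi> x))"
    by (auto simp: orbits_def)
  have "card (orbit G \<phi> x) dvd 2 ^ n"
    using orbit_stabilizer_theorem[OF x(1)] order by (metis dvd_triv_left)
  then obtain i where "card (orbit G \<phi> x) = 2 ^ i"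
    using divides_primepow_nat[OF two_is_prime_nat, THEN iffD1] by auto
  then have "card (orbit G \<phi> x) = 1" using x(2) by (cases "i = 0") simp_all
  then obtain y where y: "orbit G \<phi> x = {y}" by (auto simp: card_1_singleton_iff)
  have "x \<in> {y}" using orbit_refl[OF x(1)] unfolding y .
  moreover have "\<phi> g x \<in> {y}" if "g \<in> carrier G" for g
    using that unfolding y[symmetric] orbit_def by blast
  ultimately have "\<phi> g x = x" if "g \<in> carrier G" for g
    using that by simp
  with x(1) show thesis by (rule that)
qed


section \<open>The moved points form a center block\<close>

locale pyramidal_design =
  fixes k :: nat and P :: "'a set" and B :: "'a set set"
    and G :: "('a \<Rightarrow> 'a) set" and C :: "'a set"
  assumes k: "k \<ge> 3"
    and design: "symmetric_design (2 ^ k - 1) (2 ^ (k - 1)) (2 ^ (k - 2)) P B"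
    and pyramidal: "pyramidal_over_abelian (2 ^ (k - 1) - 1) P B G"
    and C_def: "C = P - fixed_points P G"
begin

definition q :: nat where "q = 2 ^ (k - 3)"

lemma powers: "2 ^ k = 8 * q" "2 ^ (k - 1) = 4 * q" "2 ^ (k - 2) = 2 * q" "q > 0"
proof -
  obtain j where "k = Suc (Suc (Suc j))"
    using k that[of "k - 3"] by simp
  then show "2 ^ k = 8 * q" "2 ^ (k - 1) = 4 * q" "2 ^ (k - 2) = 2 * q" "q > 0"
    unfolding q_def by simp_all
qed

lemma finite_P: "finite P" and card_P: "card P = 8 * q - 1"
  and blocks_subset: "X \<in> B \<Longrightarrow> X \<subseteq> P" and card_B: "card B = 8 * q - 1"
  and card_block: "X \<in> B \<Longrightarrow> card X = 4 * q"
  and card_inter: "X \<in> B \<Longrightarrow> Y \<in> B \<Longrightarrow> X \<noteq> Y \<Longrightarrow> card (X \<inter> Y) = 2 * q"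
  using design unfolding symmetric_design_def powers by auto

lemma finite_B: "finite B"
  using card_B powers(4) by (intro card_ge_0_finite) simp

lemma finite_block: "X \<in> B \<Longrightarrow> finite X"
  using blocks_subset finite_P finite_subset by blast

lemma C_subset: "C \<subseteq> P" by (auto simp: C_def)

lemma finite_C: "finite C"
  using C_subset finite_P finite_subset by blast

lemma card_fixed: "card (P - C) = 4 * q - 1"
proof -
  have "P - C = fixed_points P G" by (auto simp: C_def fixed_points_def)
  then show ?thesis using pyramidal unfolding pyramidal_over_abelian_def powers by simp
qed

lemma card_C: "card C = 4 * q"
  using card_fixed card_P card_Diff_subset[OF finite_C C_subset] card_mono[OF finite_P C_subset]
    powers(4) by simp

lemma comm_group_G: "comm_group ((BijGroup P)\<lparr>carrier := G\<rparr>)"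
  and subgroup_G: "subgroup G (BijGroup P)"
  using pyramidal by (auto simp: pyramidal_over_abelian_def abelian_automorphism_group_def)

lemma G_Bij: "g \<in> G \<Longrightarrow> g \<in> Bij P"
  using subgroup.subset[OF subgroup_G] by (auto simp: BijGroup_def)

lemma G_bij_betw: "g \<in> G \<Longrightarrow> bij_betw g P P"
  using G_Bij by (auto simp: Bij_def)

lemma G_inj: "g \<in> G \<Longrightarrow> x \<in> P \<Longrightarrow> y \<in> P \<Longrightarrow> g x = g y \<longleftrightarrow> x = y"
  using G_bij_betw by (auto simp: bij_betw_def dest: inj_onD)

lemma G_in_P: "g \<in> G \<Longrightarrow> x \<in> P \<Longrightarrow> g x \<in> P"
  using G_bij_betw bij_betwE by blast

lemma G_ext: "g \<in> G \<Longrightarrow> h \<in> G \<Longrightarrow> (\<And>x. x \<in> P \<Longrightarrow> g x = h x) \<Longrightarrow> g = h"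
  using G_Bij by (intro extensionalityI[of _ P]) (auto simp: Bij_def)

lemma mult_G: "g \<in> G \<Longrightarrow> h \<in> G \<Longrightarrow> g \<otimes>\<^bsub>BijGroup P\<^esub> h = compose P g h"
  using G_Bij by (simp add: BijGroup_def)

lemma compose_G: "g \<in> G \<Longrightarrow> h \<in> G \<Longrightarrow> compose P g h \<in> G"
  using subgroup.m_closed[OF subgroup_G] mult_G by force

lemma image_block: "g \<in> G \<Longrightarrow> X \<in> B \<Longrightarrow> g ` X \<in> B"
  using pyramidal unfolding pyramidal_over_abelian_def abelian_automorphism_group_def
    automorphisms_def design_iso_def by (auto dest!: subsetD bij_betwE)

lemma fixes_outside: "g \<in> G \<Longrightarrow> x \<in> P \<Longrightarrow> x \<notin> C \<Longrightarrow> g x = x"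
  by (auto simp: C_def fixed_points_def)

lemma G_in_C_iff: "g \<in> G \<Longrightarrow> x \<in> P \<Longrightarrow> g x \<in> C \<longleftrightarrow> x \<in> C"
  using fixes_outside G_inj G_in_P by metis

lemma transitive: "x \<in> C \<Longrightarrow> y \<in> C \<Longrightarrow> \<exists>g\<in>G. g x = y"
  using pyramidal C_def by (auto simp: pyramidal_over_abelian_def sharply_transitive_on_def)

lemma trivial_stabilizer: "g \<in> G \<Longrightarrow> x \<in> C \<Longrightarrow> g x = x \<Longrightarrow> g = (\<lambda>x\<in>P. x)"
  using pyramidal C_def
  by (auto simp: pyramidal_over_abelian_def sharply_transitive_on_def BijGroup_def)

text \<open>The element \<open>f\<close> of the proof brings \<open>g x\<close> back to \<open>x\<close>, so \<open>f \<circ> g\<close> and \<open>f \<circ> h\<close> both lie in the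
  trivial stabilizer of \<open>x\<close>.\<close>

lemma sharp:
  assumes "g \<in> G" "h \<in> G" "x \<in> C" "g x = h x"
  shows "g = h"
proof -
  have x: "x \<in> P" "g x \<in> C" using assms C_subset G_in_C_iff by auto
  then obtain f where f: "f \<in> G" "f (g x) = x" using transitive assms by blast
  have "compose P f g = (\<lambda>x\<in>P. x)" "compose P f h = (\<lambda>x\<in>P. x)"
    using f assms x by (auto intro!: trivial_stabilizer[of _ x] compose_G simp: compose_eq)
  then have "f (g y) = f (h y)" if "y \<in> P" for y
    using that by (metis compose_eq)
  then show ?thesis
    using G_inj[OF f(1)] assms G_in_P by (intro G_ext) blast+
qed

lemma orbit_map:
  assumes x: "x \<in> C"
  shows "bij_betw (\<lambda>g. g x) G C"
  unfolding bij_betw_def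
proof
  show "inj_on (\<lambda>g. g x) G"
    using sharp[OF _ _ x] by (blast intro: inj_onI)
  show "(\<lambda>g. g x) ` G = C"
  proof
    show "(\<lambda>g. g x) ` G \<subseteq> C"
      using x C_subset G_in_C_iff by blast
    show "C \<subseteq> (\<lambda>g. g x) ` G"
      using transitive[OF x] by blast
  qed
qed

lemma card_G: "card G = 4 * q"
proof -
  obtain x where "x \<in> C" using card_C powers(4) by fastforce
  then show ?thesis using orbit_map bij_betw_same_card card_C by metis
qed

lemma block_action:
  "group_action ((BijGroup P)\<lparr>carrier := G\<rparr>) B (\<lambda>g. \<lambda>X\<in>B. g ` X)"
proof -
  interpret comm_group "(BijGroup P)\<lparr>carrier := G\<rparr>" by (rule comm_group_G)
  have comp: "compose P g h ` X = g ` h ` X" if "g \<in> G" "h \<in> G" "X \<in> B" for g h X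
    proof -
    have "compose P g h ` X = (\<lambda>x. g (h x)) ` X"
      using blocks_subset[OF that(3)] by (intro image_cong) (auto simp: compose_eq)
    then show ?thesis by (simp add: image_image)
  qed
  have bij: "(\<lambda>X\<in>B. g ` X) \<in> Bij B" if g: "g \<in> G" for g
  proof -
    have "inj_on ((`) g) B"
    proof (rule inj_onI)
      fix X Y assume "X \<in> B" "Y \<in> B" "g ` X = g ` Y"
      then show "X = Y"
        using G_bij_betw[OF g] blocks_subset inj_on_image_eq_iff[of g P X Y]
        by (auto simp: bij_betw_def)
    qed
    then have "inj_on (\<lambda>X\<in>B. g ` X) B" by (simp add: inj_on_def)
    moreover have "(\<lambda>X\<in>B. g ` X) ` B = B"
      using calculation image_block[OF g] finite_B
      by (intro card_subset_eq) (auto simp: card_image)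
    ultimately show ?thesis by (simp add: Bij_def bij_betw_def)
  qed
  show ?thesis
    unfolding group_action_def group_hom_def group_hom_axioms_def
  proof (intro conjI group_BijGroup is_group homI)
    fix g assume "g \<in> carrier ((BijGroup P)\<lparr>carrier := G\<rparr>)"
    then show "(\<lambda>X\<in>B. g ` X) \<in> carrier (BijGroup B)" using bij by (simp add: BijGroup_def)
  next
    fix g h assume "g \<in> carrier ((BijGroup P)\<lparr>carrier := G\<rparr>)"
      "h \<in> carrier ((BijGroup P)\<lparr>carrier := G\<rparr>)"
    then have gh: "g \<in> G" "h \<in> G" by auto
    then have "(\<lambda>X\<in>B. compose P g h ` X) = compose B (\<lambda>X\<in>B. g ` X) (\<lambda>X\<in>B. h ` X)"
      using comp[OF gh] image_block[OF gh(2)] by (simp add: compose_def restrict_def fun_eq_iff)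
    then show "(\<lambda>X\<in>B. (g \<otimes>\<^bsub>(BijGroup P)\<lparr>carrier := G\<rparr>\<^esub> h) ` X) =
        (\<lambda>X\<in>B. g ` X) \<otimes>\<^bsub>BijGroup B\<^esub> (\<lambda>X\<in>B. h ` X)"
      using gh bij by (simp add: mult_G) (simp add: BijGroup_def)
  qed
qed

text \<open>A fixed block meets \<open>C\<close>, as there are only \<open>4 q - 1\<close> points outside \<open>C\<close>. By transitivity it then
  contains \<open>C\<close>, which has as many points as a block.\<close>

lemma C_block: "C \<in> B"
proof -
  have "odd (card B)" using card_B powers(4) by simp
  moreover have "order ((BijGroup P)\<lparr>carrier := G\<rparr>) = 2 ^ (k - 1)"
    by (simp add: order_def card_G powers(2)[symmetric])
  ultimately obtain X where X: "X \<in> B" "\<And>g. g \<in> G \<Longrightarrow> g ` X = X"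
    using group_action.two_group_fixed_point[OF block_action finite_B] by auto
  have "X \<inter> C \<noteq> {}"
  proof
    assume "X \<inter> C = {}"
    then have "X \<subseteq> P - C" using blocks_subset[OF X(1)] by auto
    then have "card X \<le> card (P - C)" using finite_P by (intro card_mono) auto
    then show False using card_block[OF X(1)] card_fixed powers(4) by simp
  qed
  then obtain x where x: "x \<in> X" "x \<in> C" by blast
  have "C \<subseteq> X"
  proof
    fix y assume "y \<in> C"
    then obtain g where "g \<in> G" "g x = y" using transitive x by blast
    then show "y \<in> X" using X x by blast
  qed
  then have "C = X"
    using finite_block card_block card_C X by (intro card_subset_eq) auto
  then show ?thesis using X by simp
qed

lemma card_inter_C: "X \<in> B \<Longrightarrow> X \<noteq> C \<Longrightarrow> card (X \<inter> C) = 2 * q"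
  using card_inter C_block by blast

lemma card_diff_C: "X \<in> B \<Longrightarrow> X \<noteq> C \<Longrightarrow> card (X - C) = 2 * q"
  using card_inter_C[of X] card_block[of X] finite_C card_Diff_subset_Int[of X C] by simp

lemma card_C_diff: "X \<in> B \<Longrightarrow> X \<noteq> C \<Longrightarrow> card (C - X) = 2 * q"
  using card_inter_C[of X] card_C finite_C card_Diff_subset_Int[of C X] by (simp add: Int_commute)

text \<open>The part of \<open>X\<close> outside \<open>C\<close> is fixed pointwise and has \<open>2 q\<close> points. If \<open>g\<close> moves \<open>X\<close>, this is all
  that \<open>g ` X\<close> and \<open>X\<close> can share, so inside \<open>C\<close> they are disjoint sets of \<open>2 q\<close> points each, hence
  complementary.\<close>

lemma image_block_cases:
  assumes X: "X \<in> B" "X \<noteq> C" and g: "g \<in> G"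
  shows "g ` X = X \<or> g ` X = sym_diff C X"
proof (cases "g ` X = X")
  case neq: False
  have outside: "g ` X - C = X - C"
  proof (intro Set.set_eqI iffI)
    fix x assume "x \<in> g ` X - C"
    then obtain y where y: "y \<in> X" "x = g y" "g y \<notin> C" by blast
    then have "y \<in> P" using blocks_subset[OF X(1)] by blast
    then show "x \<in> X - C" using y fixes_outside[OF g] G_in_C_iff[OF g] by simp
  next
    fix x assume x: "x \<in> X - C"
    then have "g x = x" using blocks_subset[OF X(1)] fixes_outside[OF g] by blast
    then show "x \<in> g ` X - C" using x by (metis Diff_iff imageI)
  qed
  define Y where "Y = g ` X"
  have Y: "Y \<in> B" "Y \<noteq> X" "Y - C = X - C"
    using image_block g X neq outside by (auto simp: Y_def)
  have "card (X - C) \<noteq> 0" using card_diff_C[OF X] powers(4) by simp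
  then have "Y \<noteq> C" using Y(3) by (metis Diff_cancel card.empty)
  have "card (Y \<inter> X) = card (Y \<inter> X \<inter> C) + card (Y \<inter> X - C)"
    using finite_block[OF Y(1)] by (metis card_Int_Diff finite_Int)
  moreover have "Y \<inter> X - C = X - C" using Y(3) by blast
  ultimately have "card (Y \<inter> X \<inter> C) = 0"
    using card_inter[OF Y(1) X(1) Y(2)] card_diff_C[OF X] by simp
  then have "Y \<inter> X \<inter> C = {}" using finite_C by simp
  then have "Y \<inter> C \<subseteq> C - X" by blast
  then have "Y \<inter> C = C - X"
    using card_inter_C[OF Y(1) \<open>Y \<noteq> C\<close>] card_C_diff[OF X] finite_C
    by (intro card_subset_eq) auto
  then have "Y = sym_diff C X" using Y(3) by blast
  then show ?thesis unfolding Y_def by (rule disjI2)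
qed simp

text \<open>Transitivity supplies an element that takes a point of \<open>X \<inter> C\<close> to a point of \<open>C - X\<close> and thus moves
  \<open>X\<close>.\<close>

lemma sym_diff_block:
  assumes X: "X \<in> B" "X \<noteq> C"
  shows "sym_diff C X \<in> B"
proof -
  have "X \<inter> C \<noteq> {}" "C - X \<noteq> {}"
    using card_inter_C[OF X] card_C_diff[OF X] powers(4)
    by (metis card.empty mult_pos_pos not_gr0 zero_less_numeral)+
  then obtain x y where "x \<in> X \<inter> C" "y \<in> C - X" by blast
  moreover from this obtain g where g: "g \<in> G" "g x = y" using transitive by blast
  ultimately have "g ` X \<noteq> X" by blast
  then show ?thesis using image_block_cases[OF X g(1)] image_block[OF g(1) X(1)] by auto
qed

lemma center_block: "center_block B C"
  using C_block sym_diff_block by (auto simp: center_block_def)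

text \<open>\<open>Y\<close> meets both \<open>X\<close> and \<open>C \<triangle> X\<close> in \<open>2 q\<close> points. These two blocks agree outside \<open>C\<close> and are
  complementary inside \<open>C\<close>, so \<open>X\<close> bisects \<open>Y \<inter> C\<close>.\<close>

lemma card_triple_inter:
  assumes X: "X \<in> B" "X \<noteq> C" and Y: "Y \<in> B" "Y \<noteq> C" and "X \<noteq> Y" "sym_diff C X \<noteq> Y"
  shows "card (X \<inter> Y \<inter> C) = q" "card (X \<inter> Y - C) = q"
proof -
  have "card (X \<inter> Y) = card (X \<inter> Y \<inter> C) + card (X \<inter> Y - C)"
    using finite_block X by (metis card_Int_Diff finite_Int)
  moreover have "card (sym_diff C X \<inter> Y) = card (sym_diff C X \<inter> Y \<inter> C) + card (sym_diff C X \<inter> Y - C)"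
    using finite_block Y by (metis card_Int_Diff finite_Int)
  moreover have "sym_diff C X \<inter> Y \<inter> C = Y \<inter> C - X" "sym_diff C X \<inter> Y - C = X \<inter> Y - C" by auto
  moreover have "card (Y \<inter> C) = card (Y \<inter> C \<inter> X) + card (Y \<inter> C - X)"
    using finite_C by (metis card_Int_Diff finite_Int)
  moreover have "Y \<inter> C \<inter> X = X \<inter> Y \<inter> C" by auto
  moreover have "card (X \<inter> Y) = 2 * q" "card (sym_diff C X \<inter> Y) = 2 * q"
    using card_inter[OF X(1) Y(1)] card_inter[OF sym_diff_block[OF X] Y(1)] assms(5,6) by simp_all
  ultimately show "card (X \<inter> Y \<inter> C) = q" "card (X \<inter> Y - C) = q"
    using card_inter_C[OF Y] by simp_all
qed

end


section \<open>The Hadamard matrix of the design\<close>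

locale pointed_pyramidal_design = pyramidal_design +
  fixes base :: 'a
  assumes base_in_C: "base \<in> C"
begin

text \<open>The blocks other than \<open>C\<close> come in pairs \<open>X\<close>, \<open>C \<triangle> X\<close>; the point \<open>base\<close>, which lies in \<open>C\<close>, selects
  one block of each pair.\<close>

definition avoiding :: "'a set set" where "avoiding = {X \<in> B. base \<notin> X}"

lemma avoidingD: "X \<in> avoiding \<Longrightarrow> X \<in> B" "X \<in> avoiding \<Longrightarrow> X \<noteq> C" "X \<in> avoiding \<Longrightarrow> base \<notin> X"
  using base_in_C by (auto simp: avoiding_def)

lemma finite_avoiding: "finite avoiding"
  using finite_B by (simp add: avoiding_def)

lemma avoiding_cases:
  assumes "X \<in> B" "X \<noteq> C"
  shows "X \<in> avoiding \<or> sym_diff C X \<in> avoiding"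
  using assms sym_diff_block[OF assms] base_in_C unfolding avoiding_def by blast

lemma card_avoiding: "card avoiding = 4 * q - 1"
proof -
  have inj: "inj_on (sym_diff C) avoiding" by (rule inj_onI) blast
  have B_eq: "B = insert C (avoiding \<union> sym_diff C ` avoiding)"
  proof (intro Set.set_eqI iffI)
    fix X assume X: "X \<in> B"
    have "X = sym_diff C (sym_diff C X)" by blast
    then show "X \<in> insert C (avoiding \<union> sym_diff C ` avoiding)"
      using avoiding_cases[OF X] by blast
  next
    fix X assume "X \<in> insert C (avoiding \<union> sym_diff C ` avoiding)"
    then show "X \<in> B" using C_block avoidingD sym_diff_block by blast
  qed
  have disjoint: "avoiding \<inter> sym_diff C ` avoiding = {}"
    using base_in_C avoidingD(3) by blast
  have C_notin: "C \<notin> avoiding \<union> sym_diff C ` avoiding"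
  proof
    assume "C \<in> avoiding \<union> sym_diff C ` avoiding"
    then obtain X where X: "X \<in> avoiding" "C = sym_diff C X" using avoidingD(2) by blast
    then have "X = {}" by blast
    then show False using avoidingD(1)[OF X(1)] card_block powers(4) by fastforce
  qed
  have "card (insert C (avoiding \<union> sym_diff C ` avoiding)) = Suc (2 * card avoiding)"
    using finite_avoiding inj disjoint C_notin by (simp add: card_Un_disjoint card_image)
  then have "card B = Suc (2 * card avoiding)"
    by (rule trans[OF arg_cong[OF B_eq, of card]])
  then show ?thesis using card_B by simp
qed

lemma card_inter_avoiding:
  assumes "X \<in> avoiding" "Y \<in> avoiding" "X \<noteq> Y"
  shows "card (X \<inter> Y \<inter> C) = q" "card (X \<inter> Y - C) = q"
proof -
  have "sym_diff C X \<noteq> Y" using assms avoidingD(3) base_in_C by blast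
  then show "card (X \<inter> Y \<inter> C) = q" "card (X \<inter> Y - C) = q"
    using card_triple_inter[of X Y] assms avoidingD by blast+
qed

text \<open>The two blocks of a pair agree outside \<open>C\<close>, so the blocks that avoid \<open>base\<close> represent all traces
  on \<open>P - C\<close>, each of them once.\<close>

lemma outer_design: "symmetric_design (4 * q - 1) (2 * q) q (P - C) (outer_blocks P B C)"
proof -
  have eq: "outer_blocks P B C = (\<lambda>X. X - C) ` avoiding"
  proof (intro Set.set_eqI iffI)
    fix Y assume "Y \<in> outer_blocks P B C"
    then obtain X where X: "X \<in> B" "X \<noteq> C" "Y = X \<inter> (P - C)"
      by (auto simp: outer_blocks_def)
    then have "Y = X - C" "Y = sym_diff C X - C" using blocks_subset[OF X(1)] by auto
    then show "Y \<in> (\<lambda>X. X - C) ` avoiding" using avoiding_cases[OF X(1,2)] by blast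
  next
    fix Y assume "Y \<in> (\<lambda>X. X - C) ` avoiding"
    then obtain X where X: "X \<in> avoiding" "Y = X - C" by blast
    then have "Y = X \<inter> (P - C)" using blocks_subset[OF avoidingD(1)[OF X(1)]] by auto
    then show "Y \<in> outer_blocks P B C" using avoidingD[OF X(1)] by (auto simp: outer_blocks_def)
  qed
  have inter: "(X - C) \<inter> (Y - C) = X \<inter> Y - C" for X Y by auto
  have inj: "inj_on (\<lambda>X. X - C) avoiding"
  proof (rule inj_onI, rule ccontr)
    fix X Y assume XY: "X \<in> avoiding" "Y \<in> avoiding" "X - C = Y - C" "X \<noteq> Y"
    then have "X \<inter> Y - C = X - C" by blast
    then show False
      using card_inter_avoiding[OF XY(1,2,4)] card_diff_C[OF avoidingD(1,2)[OF XY(1)]] powers(4) by simp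
  qed
  show ?thesis
    unfolding symmetric_design_def eq
  proof (intro conjI ballI impI)
    show "card ((\<lambda>X. X - C) ` avoiding) = 4 * q - 1" using inj card_avoiding by (simp add: card_image)
    show "(\<lambda>X. X - C) ` avoiding \<subseteq> Pow (P - C)" using blocks_subset avoidingD by blast
  next
    fix X assume "X \<in> (\<lambda>X. X - C) ` avoiding"
    then obtain Y where Y: "Y \<in> avoiding" "X = Y - C" by blast
    show "card X = 2 * q" using card_diff_C[OF avoidingD(1,2)[OF Y(1)]] Y(2) by simp
  next
    fix X Y assume "X \<in> (\<lambda>X. X - C) ` avoiding" "Y \<in> (\<lambda>X. X - C) ` avoiding" "X \<noteq> Y"
    then obtain X' Y' where "X' \<in> avoiding" "Y' \<in> avoiding" "X' \<noteq> Y'" "X = X' - C" "Y = Y' - C" by blast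
    then show "card (X \<inter> Y) = q" using card_inter_avoiding(2) by (simp add: inter)
  qed (use finite_P card_fixed in auto)
qed

text \<open>The empty set stands for the all-one row, which corresponds to the trivial character.\<close>

definition rows :: "'a set set" where "rows = insert {} avoiding"

definition sign :: "'a set \<Rightarrow> 'a \<Rightarrow> int" where "sign X x = (if x \<in> X then - 1 else 1)"

lemma finite_rows: "finite rows" by (simp add: rows_def finite_avoiding)

lemma empty_notin_avoiding: "{} \<notin> avoiding"
  using avoidingD(1) card_block powers(4) by fastforce

lemma card_rows: "card rows = 4 * q"
  using empty_notin_avoiding finite_avoiding card_avoiding powers(4) by (simp add: rows_def)

lemma sign_square: "sign X x * sign X x = 1"
  by (simp add: sign_def)

lemma sign_base: "X \<in> rows \<Longrightarrow> sign X base = 1"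
  using avoidingD(3) by (auto simp: rows_def sign_def)

lemma sum_sign_sign:
  "(\<Sum>x\<in>C. sign X x * sign Y x) =
     int (card C) - 2 * int (card (X \<inter> C)) - 2 * int (card (Y \<inter> C)) + 4 * int (card (X \<inter> Y \<inter> C))"
proof -
  \<comment> \<open>The sign vector of \<open>S\<close> is \<open>1 - 2 i S\<close>.\<close>
  define i :: "'a set \<Rightarrow> 'a \<Rightarrow> int" where "i = (\<lambda>S x. if x \<in> S then 1 else (0 :: int))"
  have i: "(\<Sum>x\<in>C. i S x) = int (card (S \<inter> C))" for S
    using finite_C by (simp add: i_def sum.If_cases Int_commute)
  have "(\<Sum>x\<in>C. sign X x * sign Y x) = (\<Sum>x\<in>C. 1 - 2 * i X x - 2 * i Y x + 4 * i (X \<inter> Y) x)"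
    by (intro sum.cong) (auto simp: sign_def i_def)
  then show ?thesis
    by (simp add: sum.distrib sum_subtractf i flip: sum_distrib_left)
qed

lemma rows_orthogonal:
  assumes "X \<in> rows" "Y \<in> rows"
  shows "(\<Sum>x\<in>C. sign X x * sign Y x) = (if X = Y then int (4 * q) else 0)"
proof (cases "X = Y")
  case True
  then show ?thesis using card_C by (simp add: sign_square)
next
  case False
  have "card (Z \<inter> C) = 2 * q" if "Z \<in> avoiding" for Z
    using that card_inter_C avoidingD by blast
  then have "(\<Sum>x\<in>C. sign X x * sign Y x) = 0"
    using assms False card_C card_inter_avoiding(1)[of X Y] unfolding sum_sign_sign rows_def
    by (elim insertE) auto
  then show ?thesis using False by simp
qed

lemma columns_orthogonal:
  assumes "x \<in> C" "y \<in> C" "x \<noteq> y"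
  shows "(\<Sum>X\<in>rows. sign X x * sign X y) = 0"
  using orthogonal_rows_imp_orthogonal_columns[of rows C "4 * q" sign x y] assms
    finite_rows finite_C card_rows card_C rows_orthogonal sign_square by simp

lemma columns_separate:
  assumes "x \<in> C" "y \<in> C" and eq: "\<And>X. X \<in> rows \<Longrightarrow> sign X x = sign X y"
  shows "x = y"
proof (rule ccontr)
  assume "x \<noteq> y"
  have "(\<Sum>X\<in>rows. sign X x * sign X y) = (\<Sum>X\<in>rows. 1)"
    using eq by (intro sum.cong) (auto simp: sign_square)
  then show False
    using columns_orthogonal[OF assms(1,2) \<open>x \<noteq> y\<close>] card_rows powers(4) by simp
qed

text \<open>Identify \<open>y = h base\<close> with \<open>h \<in> G\<close>: then \<open>X\<close> becomes a character of \<open>G\<close>, whose kernel is the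
  stabilizer of \<open>X\<close>. Indeed \<open>g\<close> either preserves \<open>X\<close> or exchanges \<open>X \<inter> C\<close> with \<open>C - X\<close>, and
  \<open>base \<notin> X\<close> shows which of the two happens.\<close>

lemma sign_mult:
  assumes X: "X \<in> rows" and g: "g \<in> G" and y: "y \<in> C"
  shows "sign X (g y) = sign X (g base) * sign X y"
proof (cases "X = {}")
  case False
  then have avoiding: "X \<in> avoiding" using X by (simp add: rows_def)
  have "X \<subseteq> P" using avoidingD(1)[OF avoiding] blocks_subset by blast
  then have image: "g x \<in> g ` X \<longleftrightarrow> x \<in> X" if "x \<in> C" for x
    using that C_subset G_inj[OF g] by blast
  have gC: "g x \<in> C" if "x \<in> C" for x using that C_subset G_in_C_iff[OF g] by blast
  consider "g ` X = X" | "g ` X = sym_diff C X"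
    using image_block_cases[OF avoidingD(1,2)[OF avoiding] g] by blast
  then show ?thesis
  proof cases
    case 1
    then show ?thesis
      using image[OF y] image[OF base_in_C] avoidingD(3)[OF avoiding] by (simp add: sign_def)
  next
    case 2
    then have "g x \<in> X \<longleftrightarrow> x \<notin> X" if "x \<in> C" for x
      using image[OF that] gC[OF that] by blast
    then show ?thesis using y base_in_C avoidingD(3)[OF avoiding] by (simp add: sign_def)
  qed
qed (simp add: sign_def)

text \<open>A sign character takes the value \<open>1\<close> at every square, and the characters separate the points of \<open>C\<close>.\<close>

lemma involution:
  assumes g: "g \<in> G" and x: "x \<in> P"
  shows "g (g x) = x"
proof (cases "x \<in> C")
  case True
  then have gx: "g x \<in> C" using x g G_in_C_iff by blast
  then have ggx: "g (g x) \<in> C" using x g G_in_C_iff G_in_P by blast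
  show ?thesis
  proof (rule columns_separate[OF ggx True])
    fix X assume X: "X \<in> rows"
    show "sign X (g (g x)) = sign X x"
      using sign_mult[OF X g gx] sign_mult[OF X g True] sign_square[of X "g base"]
      by (simp flip: mult.assoc)
  qed
qed (use fixes_outside[OF g x] in simp)


section \<open>Identification of \<open>G\<close> with \<open>C2_group P B C (C - {base})\<close>\<close>

definition translation :: "'a \<Rightarrow> 'a \<Rightarrow> 'a" where
  "translation p = (THE g. g \<in> G \<and> g base = p)"

lemma translation:
  assumes "p \<in> C"
  shows "translation p \<in> G" "translation p base = p"
proof -
  have "\<exists>!g. g \<in> G \<and> g base = p"
    using transitive[OF base_in_C assms] sharp[OF _ _ base_in_C] by blast
  then have "translation p \<in> G \<and> translation p base = p"
    unfolding translation_def by (rule theI')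
  then show "translation p \<in> G" "translation p base = p" by simp_all
qed

lemma translation_image: "translation ` C = G"
proof
  show "G \<subseteq> translation ` C"
  proof
    fix g assume g: "g \<in> G"
    then have "g base \<in> C" using base_in_C C_subset G_in_C_iff by blast
    moreover from this have "translation (g base) = g"
      using translation sharp[OF _ g base_in_C] by blast
    ultimately show "g \<in> translation ` C" by force
  qed
qed (use translation in auto)

lemma translation_base: "translation base = (\<lambda>x\<in>P. x)"
  using trivial_stabilizer translation base_in_C by blast

lemma sign_translation:
  "X \<in> rows \<Longrightarrow> p \<in> C \<Longrightarrow> x \<in> C \<Longrightarrow> sign X (translation p x) = sign X p * sign X x"
  using sign_mult translation by metis

lemma translation_in_C: "p \<in> C \<Longrightarrow> x \<in> C \<Longrightarrow> translation p x \<in> C"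
  using translation G_in_C_iff C_subset by blast

text \<open>The signs at \<open>p\<close>, at \<open>x\<close> and at \<open>translation p x\<close> multiply to \<open>1\<close>, so they cannot all be \<open>-1\<close>.\<close>

lemma no_block_through_translate:
  assumes "p \<in> C" "x \<in> C" "X \<in> avoiding" "p \<in> X" "x \<in> X"
  shows "translation p x \<notin> X"
proof
  assume "translation p x \<in> X"
  moreover have "X \<in> rows" using assms by (simp add: rows_def)
  ultimately show False
    using sign_translation[of X p x] assms by (simp add: sign_def)
qed

text \<open>The product \<open>(1 - \<chi> p) (1 - \<chi> x) (1 - \<chi> t)\<close> is nonzero only for a row \<open>\<chi>\<close> with sign \<open>-1\<close> at all
  three points. In its expansion each term except the constant \<open>1\<close> is up to sign a product of two distinct
  columns and sums to zero over the rows: a single column is its product with the constant column of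
  \<open>base\<close>, and in the cubic term \<open>\<chi> p * \<chi> x\<close> is the entry at \<open>translation p x\<close>.\<close>

lemma block_through_three_points:
  assumes C: "p \<in> C" "x \<in> C" "t \<in> C" and base: "p \<noteq> base" "x \<noteq> base" "t \<noteq> base"
    and distinct: "p \<noteq> x" "p \<noteq> t" "x \<noteq> t" and t: "t \<noteq> translation p x"
  shows "\<exists>X\<in>avoiding. p \<in> X \<and> x \<in> X \<and> t \<in> X"
proof (rule ccontr)
  assume none: "\<not> (\<exists>X\<in>avoiding. p \<in> X \<and> x \<in> X \<and> t \<in> X)"
  let ?u = "translation p x"
  have u: "?u \<in> C" using translation_in_C C by blast
  have single: "(\<Sum>X\<in>rows. sign X y) = 0" if "y \<in> C" "y \<noteq> base" for y
  proof -
    have "(\<Sum>X\<in>rows. sign X y) = (\<Sum>X\<in>rows. sign X y * sign X base)"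
      by (intro sum.cong) (auto simp: sign_base)
    then show ?thesis using columns_orthogonal[OF that(1) base_in_C that(2)] by simp
  qed
  have zero: "(1 - sign X p) * (1 - sign X x) * (1 - sign X t) = 0" if "X \<in> rows" for X
    using that none unfolding rows_def sign_def by (cases "X = {}") auto
  have expand: "(1 - sign X p) * (1 - sign X x) * (1 - sign X t) =
      1 - sign X p - sign X x - sign X t + sign X p * sign X x + sign X p * sign X t
      + sign X x * sign X t - sign X ?u * sign X t"
    if "X \<in> rows" for X
    unfolding sign_translation[OF that C(1,2)] by (simp add: algebra_simps)
  have double: "(\<Sum>X\<in>rows. sign X p * sign X x) = 0" "(\<Sum>X\<in>rows. sign X p * sign X t) = 0"
    "(\<Sum>X\<in>rows. sign X x * sign X t) = 0" "(\<Sum>X\<in>rows. sign X ?u * sign X t) = 0"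
    using columns_orthogonal C distinct u t[symmetric] by blast+
  have "0 = (\<Sum>X\<in>rows. (1 - sign X p) * (1 - sign X x) * (1 - sign X t))"
    by (rule sum.neutral[symmetric]) (use zero in blast)
  also have "\<dots> = (\<Sum>X\<in>rows. 1 - sign X p - sign X x - sign X t + sign X p * sign X x + sign X p * sign X t
      + sign X x * sign X t - sign X ?u * sign X t)"
    by (rule sum.cong[OF refl expand])
  also have "\<dots> = int (card rows)"
    using single[OF C(1) base(1)] single[OF C(2) base(2)] single[OF C(3) base(3)] double
    by (simp add: sum.distrib sum_subtractf)
  finally show False using card_rows powers(4) by simp
qed

lemma inner_blocks_eq: "inner_blocks B C (C - {base}) = (\<lambda>X. X \<inter> C) ` avoiding"
proof -
  have "X \<noteq> C \<and> X \<inter> C \<subseteq> C - {base} \<longleftrightarrow> base \<notin> X" for X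
    using base_in_C by blast
  then show ?thesis by (auto simp: inner_blocks_def avoiding_def)
qed

lemma translation_facts:
  assumes p: "p \<in> C" "p \<noteq> base" and x: "x \<in> C"
  shows "translation p (translation p x) = x" "translation p x \<noteq> x"
    "translation p x = p \<longleftrightarrow> x = base" "translation p x = base \<longleftrightarrow> x = p"
proof -
  have inv: "translation p (translation p y) = y" if "y \<in> C" for y
    using that involution translation(1)[OF p(1)] C_subset by blast
  show "translation p (translation p x) = x" by (rule inv[OF x])
  show "translation p x \<noteq> x"
  proof
    assume "translation p x = x"
    then have "translation p = (\<lambda>x\<in>P. x)"
      using trivial_stabilizer[OF translation(1)[OF p(1)] x] by blast
    then have "translation p base = base" using base_in_C C_subset by auto
    then show False using translation(2)[OF p(1)] p(2) by simp
  qed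
  show "translation p x = p \<longleftrightarrow> x = base" "translation p x = base \<longleftrightarrow> x = p"
    using inv[OF x] inv[OF base_in_C] translation(2)[OF p(1)] by metis+
qed

text \<open>By \<open>no_block_through_translate\<close> the point \<open>translation p x\<close> is an admissible partner of \<open>x\<close>, and by
  \<open>block_through_three_points\<close> it is the only one. So the blocks force the whole partition.\<close>

lemma pairing_eq:
  assumes p: "p \<in> C - {base}"
  shows "pairing (C - {base}) (inner_blocks B C (C - {base})) p =
    (\<lambda>x. {x, translation p x}) ` (C - {base} - {p})"
proof -
  let ?Z = "C - {base}" and ?\<tau> = "translation p"
  have p': "p \<in> C" "p \<noteq> base" using p by auto
  have \<tau>: "?\<tau> x \<in> ?Z - {p}" if "x \<in> ?Z - {p}" for x
    using that translation_facts[OF p'] translation_in_C[OF p'(1)] by auto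
  let ?Q = "(\<lambda>x. {x, ?\<tau> x}) ` (?Z - {p})"
  show ?thesis
    unfolding pairing_def
  proof (rule the_equality, intro conjI ballI)
    show "partition_on (?Z - {p}) ?Q"
    proof (rule partition_onI)
      show "\<Union> ?Q = ?Z - {p}"
      proof
        show "\<Union> ?Q \<subseteq> ?Z - {p}"
        proof (rule Union_least)
          fix S assume "S \<in> ?Q"
          then obtain x where x: "x \<in> ?Z - {p}" "S = {x, ?\<tau> x}" by (auto elim: imageE)
          show "S \<subseteq> ?Z - {p}" unfolding x(2) using x(1) \<tau>[OF x(1)] by simp
        qed
        show "?Z - {p} \<subseteq> \<Union> ?Q" by (rule subsetI) (rule UnionI[OF imageI], assumption, simp)
      qed
      have "S = {z, ?\<tau> z}" if S: "S \<in> ?Q" "z \<in> S" for S z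
      proof -
        obtain x where x: "x \<in> ?Z - {p}" "S = {x, ?\<tau> x}" using S(1) by blast
        then have "?\<tau> (?\<tau> x) = x" using translation_facts(1)[OF p'] by blast
        then show ?thesis using x(2) S(2) by (metis empty_iff insert_commute insert_iff)
      qed
      then show "disjnt S S'" if "S \<in> ?Q" "S' \<in> ?Q" "S \<noteq> S'" for S S'
        using that unfolding disjnt_def by blast
    qed auto
  next
    fix S assume "S \<in> ?Q"
    then obtain x where x: "x \<in> ?Z - {p}" "S = {x, ?\<tau> x}" by blast
    have "?\<tau> x \<noteq> x" using translation_facts(2)[OF p'] x(1) by blast
    then show "card S = 2" using x(2) by simp
    fix Y assume "Y \<in> inner_blocks B C ?Z"
    then obtain X where "X \<in> avoiding" "Y = X \<inter> C" unfolding inner_blocks_eq by blast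
    then show "\<not> insert p S \<subseteq> Y"
      using no_block_through_translate[OF p'(1), of x X] x by blast
  next
    fix Q assume Q: "partition_on (?Z - {p}) Q \<and>
      (\<forall>S\<in>Q. card S = 2 \<and> (\<forall>X\<in>inner_blocks B C ?Z. \<not> insert p S \<subseteq> X))"
    have S: "S = {x, ?\<tau> x}" if Sx: "S \<in> Q" "x \<in> S" for S x
    proof -
      have "card S = 2" using Q that by blast
      then obtain t where t: "S = {x, t}" "x \<noteq> t" using Sx(2) by (auto simp: card_2_iff)
      have "S \<subseteq> ?Z - {p}" using Q that by (auto simp: partition_on_def)
      then have "x \<in> C" "t \<in> C" "x \<noteq> base" "t \<noteq> base" "p \<noteq> x" "p \<noteq> t"
        unfolding t(1) by auto
      note xt = this
      have "\<not> (p \<in> X \<and> x \<in> X \<and> t \<in> X)" if "X \<in> avoiding" for X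
      proof
        assume "p \<in> X \<and> x \<in> X \<and> t \<in> X"
        then have "insert p S \<subseteq> X \<inter> C" using t(1) p'(1) xt(1,2) by simp
        moreover have "X \<inter> C \<in> inner_blocks B C ?Z"
          using \<open>X \<in> avoiding\<close> unfolding inner_blocks_eq by (rule imageI)
        ultimately show False using Q Sx(1) by blast
      qed
      then have "t = ?\<tau> x"
        using block_through_three_points[OF p'(1) xt(1,2) p'(2) xt(3-6) t(2)] by blast
      then show ?thesis using t by simp
    qed
    have union: "\<Union> Q = ?Z - {p}" and nonempty: "{} \<notin> Q" using Q by (auto simp: partition_on_def)
    show "Q = ?Q"
    proof
      show "Q \<subseteq> ?Q"
      proof
        fix S assume "S \<in> Q"
        moreover from this obtain x where "x \<in> S" using nonempty by (metis ex_in_conv)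
        ultimately have "S = {x, ?\<tau> x}" "x \<in> ?Z - {p}" using S[of S x] union by auto
        then show "S \<in> ?Q" by (rule image_eqI)
      qed
      show "?Q \<subseteq> Q"
      proof
        fix S' assume "S' \<in> ?Q"
        then obtain x where x: "x \<in> ?Z - {p}" "S' = {x, ?\<tau> x}" by blast
        then obtain S where "S \<in> Q" "x \<in> S" using union by blast
        then show "S' \<in> Q" using S[OF \<open>S \<in> Q\<close> \<open>x \<in> S\<close>] x(2) by metis
      qed
    qed
  qed
qed

lemma alpha_eq_translation:
  assumes p: "p \<in> C - {base}"
  shows "alpha P B C (C - {base}) p = translation p"
proof -
  let ?Z = "C - {base}" and ?\<tau> = "translation p"
  have p': "p \<in> C" "p \<noteq> base" using p by auto
  have the_base: "(THE x. x \<in> C - ?Z) = base" using base_in_C by (intro the_equality) auto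
  have partner: "(THE t. {x, t} \<in> pairing ?Z (inner_blocks B C ?Z) p) = ?\<tau> x"
    if x: "x \<in> ?Z" "x \<noteq> p" for x
  proof (rule the_equality)
    show "{x, ?\<tau> x} \<in> pairing ?Z (inner_blocks B C ?Z) p"
      using x unfolding pairing_eq[OF p] by blast
    fix t assume "{x, t} \<in> pairing ?Z (inner_blocks B C ?Z) p"
    then obtain y where "y \<in> ?Z - {p}" "{x, t} = {y, ?\<tau> y}" unfolding pairing_eq[OF p] by blast
    moreover from this have "?\<tau> (?\<tau> y) = y" using translation_facts(1)[OF p'] by blast
    ultimately show "t = ?\<tau> x" by (metis doubleton_eq_iff)
  qed
  have "alpha P B C ?Z p x = ?\<tau> x" if x: "x \<in> P" for x
  proof -
    consider "x = p" | "x = base" | "x \<in> ?Z" "x \<noteq> p" "x \<noteq> base" | "x \<notin> C" using p' by blast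
    then show ?thesis
    proof cases
      case 1
      then show ?thesis using x translation_facts(4)[OF p' p'(1)] the_base by (simp add: alpha_def)
    next
      case 2
      then show ?thesis using x translation(2)[OF p'(1)] the_base p' by (simp add: alpha_def)
    next
      case 3
      then show ?thesis using x partner[OF 3(1,2)] the_base by (simp add: alpha_def)
    next
      case 4
      then show ?thesis
        using x fixes_outside[OF translation(1)[OF p'(1)] x 4] the_base p' base_in_C
        by (simp add: alpha_def) metis
    qed
  qed
  moreover have "alpha P B C ?Z p \<in> extensional P" by (simp add: alpha_def Let_def)
  moreover have "?\<tau> \<in> extensional P" using G_Bij[OF translation(1)[OF p'(1)]] by (simp add: Bij_def)
  ultimately show ?thesis by (intro extensionalityI[of _ P]) auto
qed

lemma C2_group_eq: "C2_group P B C (C - {base}) = G"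
proof -
  have "C2_group P B C (C - {base}) = insert (translation base) (translation ` (C - {base}))"
    using alpha_eq_translation by (simp add: C2_group_def BijGroup_def translation_base)
  also have "\<dots> = translation ` C" using base_in_C by blast
  finally show ?thesis by (simp add: translation_image)
qed


section \<open>The inner designs\<close>

lemma card_inner_blocks: "card (inner_blocks B C (C - {base})) = 4 * q - 1"
proof -
  have "inj_on (\<lambda>X. X \<inter> C) avoiding"
  proof (rule inj_onI, rule ccontr)
    fix X Y assume XY: "X \<in> avoiding" "Y \<in> avoiding" "X \<inter> C = Y \<inter> C" "X \<noteq> Y"
    then have "X \<inter> Y \<inter> C = X \<inter> C" by blast
    then show False
      using card_inter_avoiding[OF XY(1,2,4)] card_inter_C[OF avoidingD(1,2)[OF XY(1)]] powers(4) by simp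
  qed
  then show ?thesis by (simp add: inner_blocks_eq card_image card_avoiding)
qed

text \<open>Compose an isomorphism from \<open>\<bbbF>\<^sub>2\<^sup>k\<^sup>-\<^sup>1\<close> to \<open>G\<close> with \<open>g \<mapsto> g base\<close>. The rows of the sign matrix then
  become characters of \<open>\<bbbF>\<^sub>2\<^sup>k\<^sup>-\<^sup>1\<close>.\<close>

lemma F2_coordinates:
  "\<exists>x. bij_betw x (F2_space (k - 1)) C \<and> x 0 = base \<and>
    (\<forall>X\<in>rows. \<forall>v\<in>F2_space (k - 1). \<forall>w\<in>F2_space (k - 1).
      sign X (x (v + w)) = sign X (x v) * sign X (x w))"
proof -
  let ?G = "(BijGroup P)\<lparr>carrier := G\<rparr>" and ?V = "F2_space (k - 1)"
  interpret comm_group ?G by (rule comm_group_G)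
  have sq: "g \<otimes>\<^bsub>?G\<^esub> g = \<one>\<^bsub>?G\<^esub>" if "g \<in> carrier ?G" for g
  proof -
    have g: "g \<in> G" using that by simp
    have "compose P g g = (\<lambda>x\<in>P. x)"
      using involution[OF g] by (auto simp: compose_def restrict_def)
    then show ?thesis using mult_G[OF g g] by (simp add: BijGroup_def)
  qed
  have "card G \<noteq> 0" using card_G powers(4) by simp
  then have fin: "finite G" by (metis card.infinite)
  obtain \<psi> where \<psi>: "bij_betw \<psi> ?V (carrier ?G)"
    and hom: "\<And>v w. v \<in> ?V \<Longrightarrow> w \<in> ?V \<Longrightarrow> \<psi> (v + w) = \<psi> v \<otimes>\<^bsub>?G\<^esub> \<psi> w"
  proof (rule exponent_two_iso_F2_space[of "k - 1"])
    show "card (carrier ?G) = 2 ^ (k - 1)" using card_G powers(2) by simp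
  qed (use sq fin in auto)
  have \<psi>_G: "\<psi> v \<in> G" if "v \<in> ?V" for v using \<psi> that bij_betwE by force
  have hom': "\<psi> (v + w) = compose P (\<psi> v) (\<psi> w)" if "v \<in> ?V" "w \<in> ?V" for v w
    using hom[OF that] mult_G[OF \<psi>_G[OF that(1)] \<psi>_G[OF that(2)]] by simp
  have base_P: "base \<in> P" using base_in_C C_subset by blast
  let ?x = "\<lambda>v. \<psi> v base"
  show ?thesis
  proof (intro exI[of _ ?x] conjI ballI)
    show "bij_betw ?x ?V C"
      using bij_betw_trans[OF \<psi>, of "\<lambda>g. g base" C] orbit_map[OF base_in_C] by (simp add: comp_def)
    have "0 \<in> ?V" by (simp add: F2_space_def)
    then have "\<psi> (0 + 0) base = \<psi> 0 (\<psi> 0 base)"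
      using hom'[of 0 0] base_P by (simp only: compose_eq)
    then show "?x 0 = base" using involution[OF \<psi>_G base_P] \<open>0 \<in> ?V\<close> by simp
    fix X v w assume X: "X \<in> rows" and v: "v \<in> ?V" and w: "w \<in> ?V"
    have "\<psi> w base \<in> C"
      using G_in_C_iff[OF \<psi>_G[OF w] base_P] base_in_C by blast
    then show "sign X (?x (v + w)) = sign X (?x v) * sign X (?x w)"
      using sign_mult[OF X \<psi>_G[OF v]] hom'[OF v w] base_P by (simp only: compose_eq)
  qed
qed

text \<open>A point \<open>c \<noteq> base\<close> goes to the one-dimensional space spanned by its coordinate vector, and a block
  to the complement of the kernel of its character. The resulting injection from the \<open>4 q - 1\<close> inner blocks
  to the hyperplane complements is onto because there are no more than \<open>4 q - 1\<close> hyperplanes.\<close>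

lemma inner_design_isomorphic_PG:
  "isomorphic_designs (C - {base}) (inner_blocks B C (C - {base}))
     (PG_points (k - 2)) (PG_hyperplane_complements (k - 2))"
proof -
  let ?V = "F2_space (k - 1)" and ?Z = "C - {base}"
  have k1: "k - 2 + 1 = k - 1" using k by simp
  obtain x where bij: "bij_betw x ?V C" and x0: "x 0 = base"
    and mult: "\<And>X v w. X \<in> rows \<Longrightarrow> v \<in> ?V \<Longrightarrow> w \<in> ?V \<Longrightarrow>
      sign X (x (v + w)) = sign X (x v) * sign X (x w)"
    using F2_coordinates by blast
  have zero: "0 \<in> ?V" by (simp add: F2_space_def)
  define y where "y = the_inv_into ?V x"
  have y: "bij_betw y C ?V" unfolding y_def using bij by (rule bij_betw_the_inv_into)
  have yx: "y (x v) = v" if "v \<in> ?V" for v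
    using bij that unfolding y_def by (simp add: bij_betw_def the_inv_into_f_f)
  have xy: "x (y c) = c" if "c \<in> C" for c
    using bij that unfolding y_def by (simp add: bij_betw_def f_the_inv_into_f)
  have yV: "y c \<in> ?V" if "c \<in> C" for c using y that bij_betwE by blast
  have xC: "x v \<in> C" if "v \<in> ?V" for v using bij that bij_betwE by blast
  define f where "f = (\<lambda>c. {0, y c})"
  have y_bij: "bij_betw y ?Z (?V - {0})"
  proof (rule bij_betw_byWitness[where f' = x])
    show "\<forall>c\<in>?Z. x (y c) = c" using xy by blast
    show "\<forall>v\<in>?V - {0}. y (x v) = v" using yx by blast
    show "y ` ?Z \<subseteq> ?V - {0}"
    proof (rule image_subsetI)
      fix c assume c: "c \<in> ?Z"
      then have "y c \<noteq> 0" using xy[of c] x0 by (metis DiffD1 DiffD2 singletonI)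
      then show "y c \<in> ?V - {0}" using yV c by blast
    qed
    show "x ` (?V - {0}) \<subseteq> ?Z"
    proof (rule image_subsetI)
      fix v assume v: "v \<in> ?V - {0}"
      then have "x v \<noteq> base" using yx[of v] yx[OF zero] x0 by (metis DiffD1 DiffD2 singletonI)
      then show "x v \<in> ?Z" using xC v by blast
    qed
  qed
  have pt_bij: "bij_betw (\<lambda>v. {0, v}) (?V - {0}) (PG_points (k - 2))"
    unfolding bij_betw_def PG_points_eq k1
    by (intro conjI refl inj_onI) (metis doubleton_eq_iff)
  have f: "bij_betw f ?Z (PG_points (k - 2))"
    using bij_betw_trans[OF y_bij pt_bij] unfolding f_def comp_def .
  have image: "f ` Y \<in> PG_hyperplane_complements (k - 2)"
    if Y: "Y \<in> inner_blocks B C ?Z" for Y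
  proof -
    obtain X where X: "X \<in> avoiding" "Y = X \<inter> C" using Y unfolding inner_blocks_eq by blast
    have rows: "X \<in> rows" using X by (simp add: rows_def)
    define H where "H = {v \<in> ?V. x v \<notin> X}"
    have H_iff: "v \<in> H \<longleftrightarrow> sign X (x v) = 1" if "v \<in> ?V" for v
      using that by (simp add: H_def sign_def)
    have sign_cases: "sign X c = 1 \<or> sign X c = - 1" for c by (simp add: sign_def)
    have HV: "H \<subseteq> ?V" by (auto simp: H_def)
    have add: "v + w \<in> ?V" if "v \<in> ?V" "w \<in> ?V" for v w
      using F2.subspace_add[OF subspace_F2_space that] .
    have "H \<in> PG_hyperplanes (k - 2)"
      unfolding PG_hyperplanes_iff F2_subspace_iff k1
    proof (intro conjI ballI)
      show "0 \<in> H" using zero x0 avoidingD(3)[OF X(1)] by (simp add: H_def)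
      show "v + w \<in> H" if v: "v \<in> H" and w: "w \<in> H" for v w
      proof -
        have "v \<in> ?V" "w \<in> ?V" using HV v w by auto
        then show ?thesis
          using H_iff[of v] H_iff[of w] H_iff[OF add] v w mult[OF rows] by simp
      qed
      show "v + w \<in> H" if v: "v \<in> ?V - H" and w: "w \<in> ?V - H" for v w
      proof -
        have "v \<in> ?V" "w \<in> ?V" using v w by auto
        then show ?thesis
          using H_iff[of v] H_iff[of w] H_iff[OF add] v w mult[OF rows]
            sign_cases[of "x v"] sign_cases[of "x w"] by simp
      qed
      have "card (X \<inter> C) \<noteq> 0" using card_inter_C[OF avoidingD(1,2)[OF X(1)]] powers(4) by simp
      then have "X \<inter> C \<noteq> {}" by (metis card.empty)
      then obtain c where c: "c \<in> X" "c \<in> C" by blast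
      then have "y c \<in> ?V" "y c \<notin> H" using yV xy by (auto simp: H_def)
      then show "H \<subset> ?V" using HV by blast
    qed
    moreover have "f ` Y = {U \<in> PG_points (k - 2). \<not> U \<subseteq> H}"
    proof (intro Set.set_eqI iffI)
      fix U assume "U \<in> f ` Y"
      then obtain c where c: "c \<in> X" "c \<in> C" "U = f c" using X(2) by blast
      have "c \<noteq> base" using c(1) avoidingD(3)[OF X(1)] by blast
      then have "U \<in> PG_points (k - 2)" using f c bij_betwE by blast
      moreover have "y c \<notin> H" using xy[OF c(2)] c(1) by (simp add: H_def)
      ultimately show "U \<in> {U \<in> PG_points (k - 2). \<not> U \<subseteq> H}" using c(3) by (auto simp: f_def)
    next
      fix U assume U: "U \<in> {U \<in> PG_points (k - 2). \<not> U \<subseteq> H}"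
      then have "U \<in> f ` ?Z" using f by (simp add: bij_betw_def)
      then obtain c where c: "c \<in> C" "U = f c" by blast
      have "0 \<in> H" using zero x0 avoidingD(3)[OF X(1)] by (simp add: H_def)
      then have "y c \<notin> H" using U c(2) by (auto simp: f_def)
      then have "c \<in> X" using xy[OF c(1)] yV[OF c(1)] by (simp add: H_def)
      then show "U \<in> f ` Y" using c X(2) by blast
    qed
    ultimately show ?thesis unfolding PG_hyperplane_complements_def by blast
  qed
  have inj: "inj_on ((`) f) (inner_blocks B C ?Z)"
  proof (rule inj_onI)
    fix Y Y' assume Y: "Y \<in> inner_blocks B C ?Z" "Y' \<in> inner_blocks B C ?Z" "f ` Y = f ` Y'"
    then have "Y \<subseteq> ?Z" "Y' \<subseteq> ?Z" by (auto simp: inner_blocks_def)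
    then show "Y = Y'"
      using Y(3) inj_on_image_eq_iff[OF bij_betw_imp_inj_on[OF f]] by simp
  qed
  have complements: "PG_hyperplane_complements (k - 2) =
      (\<lambda>H. {U \<in> PG_points (k - 2). \<not> U \<subseteq> H}) ` PG_hyperplanes (k - 2)"
    by (auto simp: PG_hyperplane_complements_def)
  have fin: "finite (PG_hyperplane_complements (k - 2))"
    unfolding complements using finite_card_PG_hyperplanes by blast
  have "card (PG_hyperplane_complements (k - 2)) \<le> card (PG_hyperplanes (k - 2))"
    unfolding complements using finite_card_PG_hyperplanes by (intro card_image_le) blast
  also have "\<dots> \<le> card ((`) f ` inner_blocks B C ?Z)"
    using finite_card_PG_hyperplanes[of "k - 2"] card_inner_blocks powers(2)
    unfolding k1 card_image[OF inj] by simp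
  finally have "(`) f ` inner_blocks B C ?Z = PG_hyperplane_complements (k - 2)"
    using image fin by (intro card_seteq) auto
  then have "bij_betw ((`) f) (inner_blocks B C ?Z) (PG_hyperplane_complements (k - 2))"
    using inj by (simp add: bij_betw_def)
  with f show ?thesis
    unfolding isomorphic_designs_def design_iso_def by blast
qed

end


section \<open>The structure theorem\<close>

theorem theorem6:
  fixes k :: nat and P :: "'a set" and B :: "'a set set"
    and G :: "('a \<Rightarrow> 'a) set" and C :: "'a set"
  assumes "k \<ge> 3"
    and "symmetric_design (2 ^ k - 1) (2 ^ (k - 1)) (2 ^ (k - 2)) P B"
    and "pyramidal_over_abelian (2 ^ (k - 1) - 1) P B G"
    and "C = P - fixed_points P G"
  shows "center_block B C \<and>
    (\<exists>P1 B1. symmetric_design (2 ^ (k - 1) - 1) (2 ^ (k - 2)) (2 ^ (k - 3)) P1 B1 \<and>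
             is_sum_with_PG k P B C P1 B1) \<and>
    (\<forall>Z. Z \<subseteq> C \<and> card Z = 2 ^ (k - 1) - 1 \<longrightarrow> G = C2_group P B C Z)"
proof -
  interpret pyramidal_design k P B G C using assms by unfold_locales
  have pointed: "pointed_pyramidal_design k P B G C x" if "x \<in> C" for x
    using that by unfold_locales
  have Z: "\<exists>x\<in>C. Z = C - {x}" if "Z \<subseteq> C" "card Z = 2 ^ (k - 1) - 1" for Z
  proof -
    have "finite Z" using that(1) finite_C by (rule finite_subset)
    then have "card (C - Z) = 4 * q - (4 * q - 1)"
      using card_Diff_subset[OF _ that(1)] that(2) card_C unfolding powers by simp
    then have "card (C - Z) = 1" using powers(4) by simp
    then obtain x where "C - Z = {x}" by (auto simp: card_1_singleton_iff)
    then show ?thesis using that(1) by blast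
  qed
  have "C \<noteq> {}" using card_C powers(4) by (metis card.empty mult_is_0 not_gr0 zero_neq_numeral)
  then obtain x where "x \<in> C" by blast
  then have outer: "symmetric_design (2 ^ (k - 1) - 1) (2 ^ (k - 2)) (2 ^ (k - 3))
      (P - C) (outer_blocks P B C)"
    using pointed_pyramidal_design.outer_design[OF pointed] unfolding powers q_def[symmetric] by blast
  have "isomorphic_designs Z (inner_blocks B C Z)
      (PG_points (k - 2)) (PG_hyperplane_complements (k - 2))"
    if Z': "Z \<subseteq> C \<and> card Z = 2 ^ (k - 1) - 1" for Z
  proof -
    obtain x where x: "x \<in> C" "Z = C - {x}" using Z Z' by blast
    show ?thesis
      unfolding x(2)
      by (rule pointed_pyramidal_design.inner_design_isomorphic_PG[OF pointed[OF x(1)]])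
  qed
  then have sum: "is_sum_with_PG k P B C (P - C) (outer_blocks P B C)"
    unfolding is_sum_with_PG_def by blast
  have group: "G = C2_group P B C Z" if Z': "Z \<subseteq> C \<and> card Z = 2 ^ (k - 1) - 1" for Z
  proof -
    obtain x where x: "x \<in> C" "Z = C - {x}" using Z Z' by blast
    show ?thesis
      unfolding x(2)
      by (rule pointed_pyramidal_design.C2_group_eq[OF pointed[OF x(1)], symmetric])
  qed
  show ?thesis using center_block outer sum group by blast
qed

end
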